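(* For integers $m\ge 2$, $n\ge 0$ and $0\le k\le m-1$, $$X_{L^{(k)}_{m,n}}(\mathbf{x};q)=[m-k-1]_q[m-2]_q!\left([m+n]_q\,e_{m+n}+\sum_{i=0}^{n-1}q[m+i-1]_q\,X_{P_{n-i}}(\mathbf{x};q)\,e_{m+i}\right)+q^{m-k-1}[k]_q[m-2]_q!\,X_{P_{n+1}}(\mathbf{x};q)\,e_{m-1}.$$ Consequently $X_{L^{(k)}_{m,n}}(\mathbf{x};q)$ is $e$-positive and $e$-unimodal with center of symmetry $|E(L^{(k)}_{m,n})|/2$.
   Context: $[k]_q=1+q+\dots+q^{k-1}$ ($[0]_q=0$), $[k]_q!=[1]_q\cdots[k]_q$ ($[0]_q!=1$), $e_k$ elementary symmetric function. For a graph $G$ on a vertex set of positive integers, $X_G(\mathbf{x};q)=\sum_\kappa q^{\mathrm{asc}(\kappa)}x^\kappa$ over proper colorings $\kappa:V(G)\to\mathbb{Z}_{>0}$, where $\mathrm{asc}(\kappa)$ counts edges $\{u,v\}$ with $u<v$, $\kappa(u)<\kappa(v)$, and $x^\kappa=\prod_vx_{\kappa(v)}$. $P_{k}$ is the path on $[k]$ with edges $\{j,j+1\}$. The lollipop graph $L_{m,n}$ is the graph on $[m+n]$ with edges $\{j,j+1\}$ for $1\le j\le n$ and all pairs of distinct elements of $\{n+1,\dots,n+m\}$; the melting lollipop graph $L^{(k)}_{m,n}$ is obtained from it by deleting the $k$ edges $\{n+1,n+m\},\{n+1,n+m-1\},\dots,\{n+1,n+m-k+1\}$. Writing $f=\sum_t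 c_t(\mathbf{x})q^t$: $f$ is $e$-positive if every $c_t$ is a nonnegative combination of the $e_\lambda$; $f$ is $e$-unimodal with center of symmetry $c$ if $c_t=c_{2c-t}$ for all $t$ and $c_{t+1}-c_t$ is $e$-positive for $0\le t<c-\tfrac12$. *)

theory Defs
  imports
    "HOL-Library.Multiset"
    "HOL-Library.FuncSet"
    "HOL-Computational_Algebra.Polynomial"
begin

section \<open>Formal power series in arbitrarily many commuting variables\<close>

text \<open>
  A monomial in the variables \<open>x\<^sub>v\<close>, with \<open>v\<close> ranging over the type \<open>'v\<close>, is a finite multiset
  over \<open>'v\<close>; a series is its family of coefficients.
\<close>

typedef ('v, 'a) mvps = "UNIV :: ('v multiset \<Rightarrow> 'a) set"
  morphisms mvps_nth Abs_mvps
  by simp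

lemma mvps_nth_Abs_mvps [simp]: "mvps_nth (Abs_mvps f) = f"
  by (simp add: Abs_mvps_inverse)

lemma mvps_eqI: "(\<And>M. mvps_nth f M = mvps_nth g M) \<Longrightarrow> f = g"
  by (metis ext mvps_nth_inject)

lemma finite_submultisets [simp]: "finite {A. A \<subseteq># M}"
proof (induction M)
  case (add x M)
  have "{A. A \<subseteq># add_mset x M} \<subseteq> {A. A \<subseteq># M} \<union> add_mset x ` {A. A \<subseteq># M}"
  proof
    fix A assume "A \<in> {A. A \<subseteq># add_mset x M}"
    then have A: "A \<subseteq># add_mset x M" by simp
    show "A \<in> {A. A \<subseteq># M} \<union> add_mset x ` {A. A \<subseteq># M}"
    proof (cases "x \<in># A")
      case True
      then obtain B where "A = add_mset x B" by (metis insert_DiffM)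
      with A show ?thesis by simp
    next
      case False
      with A show ?thesis
        by (metis Un_iff diff_single_trivial mem_Collect_eq subset_eq_diff_conv union_commute
            add_mset_add_single)
    qed
  qed
  with add show ?case by (meson finite_UnI finite_imageI finite_subset)
qed simp

instantiation mvps :: (type, comm_ring_1) comm_ring_1
begin

definition zero_mvps_def: "0 = Abs_mvps (\<lambda>_. 0)"

definition one_mvps_def: "1 = Abs_mvps (\<lambda>M. if M = {#} then 1 else 0)"

definition plus_mvps_def: "f + g = Abs_mvps (\<lambda>M. mvps_nth f M + mvps_nth g M)"

definition minus_mvps_def: "f - g = Abs_mvps (\<lambda>M. mvps_nth f M - mvps_nth g M)"

definition uminus_mvps_def: "- f = Abs_mvps (\<lambda>M. - mvps_nth f M)"

definition times_mvps_def:
  "f * g = Abs_mvps (\<lambda>M. \<Sum>A | A \<subseteq># M. mvps_nth f A * mvps_nth g (M - A))"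

instance
proof
  fix f g h :: "('a, 'b) mvps"
  show "f * g * h = f * (g * h)"
  proof (rule mvps_eqI)
    fix M :: "'a multiset"
    have "mvps_nth (f * g * h) M =
        (\<Sum>(A, B)\<in>(SIGMA A:{A. A \<subseteq># M}. {B. B \<subseteq># A}).
          mvps_nth f B * mvps_nth g (A - B) * mvps_nth h (M - A))"
      by (simp add: times_mvps_def sum_distrib_right sum.Sigma)
    also have "\<dots> = (\<Sum>(B, C)\<in>(SIGMA B:{B. B \<subseteq># M}. {C. C \<subseteq># M - B}).
          mvps_nth f B * (mvps_nth g C * mvps_nth h (M - B - C)))"
    proof (rule sum.reindex_bij_witness[where i = "\<lambda>(B, C). (B + C, B)" and j = "\<lambda>(A, B). (B, A - B)"],
        goal_cases)
      case (2 a)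
      then show ?case
        by (auto simp: subseteq_mset_def diff_le_mono intro: order_trans)
    next
      case (4 b)
      then show ?case
        by (auto simp: subseteq_mset_def)
          (metis add.commute add_le_mono le_add_diff_inverse2 nat_add_left_cancel_le)
    qed (auto simp: mult.assoc)
    also have "\<dots> = mvps_nth (f * (g * h)) M"
      by (simp add: times_mvps_def sum_distrib_left sum.Sigma)
    finally show "mvps_nth (f * g * h) M = mvps_nth (f * (g * h)) M" .
  qed
  show "f * g = g * f"
  proof (rule mvps_eqI)
    fix M :: "'a multiset"
    show "mvps_nth (f * g) M = mvps_nth (g * f) M"
      unfolding times_mvps_def mvps_nth_Abs_mvps
      by (rule sum.reindex_bij_witness[where i = "\<lambda>A. M - A" and j = "\<lambda>A. M - A"])
        (auto simp: subset_mset.diff_diff_right mult.commute)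
  qed
  show "1 * f = f"
  proof (rule mvps_eqI)
    fix M :: "'a multiset"
    have "mvps_nth (1 * f) M = (\<Sum>A | A \<subseteq># M. if A = {#} then mvps_nth f M else 0)"
      unfolding times_mvps_def one_mvps_def mvps_nth_Abs_mvps by (intro sum.cong) auto
    then show "mvps_nth (1 * f) M = mvps_nth f M" by simp
  qed
  show "(f + g) * h = f * h + g * h"
    by (rule mvps_eqI)
      (simp add: times_mvps_def plus_mvps_def distrib_right sum.distrib)
  show "(0 :: ('a, 'b) mvps) \<noteq> 1"
  proof
    assume "(0 :: ('a, 'b) mvps) = 1"
    then have "mvps_nth (0 :: ('a, 'b) mvps) {#} = mvps_nth 1 {#}" by simp
    then show False by (simp add: zero_mvps_def one_mvps_def)
  qed
qed (auto intro!: mvps_eqI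
      simp: plus_mvps_def minus_mvps_def uminus_mvps_def zero_mvps_def algebra_simps)

end

definition mvps_const :: "'a::comm_ring_1 \<Rightarrow> ('v, 'a) mvps" where
  "mvps_const c = Abs_mvps (\<lambda>M. if M = {#} then c else 0)"

section \<open>Power series in \<open>x\<^sub>1, x\<^sub>2, \<dots>\<close> over \<open>\<int>[q]\<close>\<close>

text \<open>
  Only the variables \<open>x\<^sub>i\<close> with \<open>i > 0\<close> occur in the series defined below. The indeterminate of
  the coefficient ring \<^typ>\<open>int poly\<close> is \<open>q\<close>.
\<close>

definition qvar :: "(nat, int poly) mvps" where
  "qvar = mvps_const (monom 1 1)"

definition qint :: "'a::comm_semiring_1 \<Rightarrow> nat \<Rightarrow> 'a" where
  "qint q k = (\<Sum>j<k. q ^ j)"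

definition qfact :: "'a::comm_semiring_1 \<Rightarrow> nat \<Rightarrow> 'a" where
  "qfact q k = (\<Prod>j = 1..k. qint q j)"

definition elem_sym :: "nat \<Rightarrow> (nat, 'a::comm_ring_1) mvps" where
  "elem_sym k = Abs_mvps (\<lambda>M.
     of_nat (card {S. finite S \<and> S \<subseteq> {0<..} \<and> card S = k \<and> mset_set S = M}))"

text \<open>
  The coefficient \<open>c\<^sub>t(x)\<close> of \<open>q\<^sup>t\<close>, for an arbitrary integer \<open>t\<close>: unimodality refers
  to \<open>c\<^sub>t\<close> also for exponents \<open>t\<close> that are negative.
\<close>

definition q_coeff :: "(nat, int poly) mvps \<Rightarrow> int \<Rightarrow> (nat, int) mvps" where
  "q_coeff f t = Abs_mvps (\<lambda>M. if t < 0 then 0 else coeff (mvps_nth f M) (nat t))"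

text \<open>A partition is the multiset of its parts.\<close>

definition e_partition :: "nat multiset \<Rightarrow> (nat, int) mvps" where
  "e_partition \<mu> = (\<Prod>i\<in>#\<mu>. elem_sym i)"

text \<open>
  Integer coefficients lose no generality: the \<open>e\<^sub>\<mu>\<close> are a \<open>\<int>\<close>-basis of the symmetric functions
  over \<open>\<int>\<close>, so the real coefficients of an integral series in this basis are integers.
\<close>

definition e_nonneg :: "(nat, int) mvps \<Rightarrow> bool" where
  "e_nonneg g \<longleftrightarrow> (\<exists>S a. finite S \<and> (\<forall>\<mu>\<in>S. 0 \<notin># \<mu> \<and> 0 \<le> a \<mu>) \<and>
     g = (\<Sum>\<mu>\<in>S. of_int (a \<mu>) * e_partition \<mu>))"

definition e_positive :: "(nat, int poly) mvps \<Rightarrow> bool" where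
  "e_positive f \<longleftrightarrow> (\<forall>t. e_nonneg (q_coeff f t))"

text \<open>The centre \<open>c\<close> may be a half-integer; \<open>d\<close> is the integer \<open>2 c\<close>.\<close>

definition e_unimodal :: "(nat, int poly) mvps \<Rightarrow> rat \<Rightarrow> bool" where
  "e_unimodal f c \<longleftrightarrow> (\<exists>d :: int. 2 * c = of_int d \<and>
     (\<forall>t. q_coeff f t = q_coeff f (d - t)) \<and>
     (\<forall>t. 0 \<le> t \<and> of_int t < c - 1 / 2 \<longrightarrow> e_nonneg (q_coeff f (t + 1) - q_coeff f t)))"

section \<open>Chromatic quasisymmetric functions\<close>

text \<open>A graph is a pair of a finite vertex set and a set of two-element subsets of it.\<close>

type_synonym nat_graph = "nat set \<times> nat set set"

definition verts :: "nat_graph \<Rightarrow> nat set" where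
  "verts G = fst G"

definition edges :: "nat_graph \<Rightarrow> nat set set" where
  "edges G = snd G"

definition proper_colorings :: "nat_graph \<Rightarrow> (nat \<Rightarrow> nat) set" where
  "proper_colorings G =
     {\<kappa> \<in> verts G \<rightarrow>\<^sub>E {0<..}. \<forall>u v. {u, v} \<in> edges G \<longrightarrow> \<kappa> u \<noteq> \<kappa> v}"

definition asc :: "nat_graph \<Rightarrow> (nat \<Rightarrow> nat) \<Rightarrow> nat" where
  "asc G \<kappa> = card {e \<in> edges G. \<exists>u v. e = {u, v} \<and> u < v \<and> \<kappa> u < \<kappa> v}"

definition coloring_monom :: "nat_graph \<Rightarrow> (nat \<Rightarrow> nat) \<Rightarrow> nat multiset" where
  "coloring_monom G \<kappa> = image_mset \<kappa> (mset_set (verts G))"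

text \<open>
  The coefficient of a monomial \<open>M\<close> is a finite sum, as a coloring with monomial \<open>M\<close>
  takes its values in the finite set of elements of \<open>M\<close>.
\<close>

definition chromatic_qsym :: "nat_graph \<Rightarrow> (nat, int poly) mvps" where
  "chromatic_qsym G = Abs_mvps (\<lambda>M.
     \<Sum>\<kappa> | \<kappa> \<in> proper_colorings G \<and> coloring_monom G \<kappa> = M. monom 1 (asc G \<kappa>))"

definition path_graph :: "nat \<Rightarrow> nat_graph" where
  "path_graph k = ({1..k}, {{j, j + 1} | j. 1 \<le> j \<and> j + 1 \<le> k})"

definition lollipop :: "nat \<Rightarrow> nat \<Rightarrow> nat_graph" where
  "lollipop m n = ({1..m + n},
     {{j, j + 1} | j. 1 \<le> j \<and> j \<le> n} \<union>
     {{u, v} | u v. u \<in> {n + 1..n + m} \<and> v \<in> {n + 1..n + m} \<and> u \<noteq> v})"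

definition melting_lollipop :: "nat \<Rightarrow> nat \<Rightarrow> nat \<Rightarrow> nat_graph" where
  "melting_lollipop k m n = (verts (lollipop m n),
     edges (lollipop m n) - {{n + 1, n + m - j} | j. j < k})"

end

(*
Write A_k for the series of L^(k)_{m,n}. Two neighbors u, u + 1 of the vertex n + 1 that are twins satisfy a
modular law, A_k + q A_{k+2} = (1 + q) A_{k+1}, so that
A_k = A_{m-1} + [m-k-1] (A_{m-2} - A_{m-1}). Here L^(m-1)_{m,n} is the disjoint union of a path and a
clique, while L^(m-2)_{m,n} = L_{m-1,n+1}. For fixed m + n, the case k = 0 therefore expresses L_{m-1,n+1}
through L_{m,n}, starting from the clique n = 0, after cancellation of a factor [m-1].
For unimodality, every summand of the formula is a product of elements in cones spanned by the
q^j [l+1] e_mu with fixed 2 j + l, which multiply by the Clebsch-Gordan rule.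
*)

theory Submission
  imports Defs "HOL-Combinatorics.Transposition"
begin

text \<open>At k = 0 the unknown series enters with the factor [m-1], which can be cancelled because
  constants from Z[q] act coefficientwise. The coefficient q [m+i-1] in the bracket is [m+i] - 1,
  left over from the disjoint union each time a head shrinks. Written with the slope of the
  recurrence, the formula carries a negative copy of the path-clique product; the splitting [m-1] =
  [m-k-1] + q^(m-k-1) [k] absorbs it, so that only nonnegative summands remain. Unimodality alone
  survives neither sums nor products, whereas the cones survive both once 2 j + l is tracked: it
  adds up under products, and every nonzero summand reaches the value |E|. The formula also involves
  path series, whose positivity is part of the problem; paths are themselves the lollipops with m =
  2, and their formula involves only shorter paths.\<close>

section \<open>Series and \<open>q\<close>-integers\<close>

lemma mvps_nth_zero [simp]: "mvps_nth 0 M = 0"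
  and mvps_nth_one: "mvps_nth 1 M = (if M = {#} then 1 else 0)"
  and mvps_nth_add [simp]: "mvps_nth (f + g) M = mvps_nth f M + mvps_nth g M"
  and mvps_nth_mult: "mvps_nth (f * g) M = (\<Sum>A | A \<subseteq># M. mvps_nth f A * mvps_nth g (M - A))"
  by (simp_all add: zero_mvps_def one_mvps_def plus_mvps_def times_mvps_def)

lemma mvps_nth_sum: "mvps_nth (sum f S) M = (\<Sum>x\<in>S. mvps_nth (f x) M)"
  by (induction S rule: infinite_finite_induct) auto

lemma mvps_nth_const_mult [simp]: "mvps_nth (mvps_const c * f) M = c * mvps_nth f M"
proof -
  have "mvps_nth (mvps_const c * f) M = (\<Sum>A | A \<subseteq># M. if A = {#} then c * mvps_nth f M else 0)"
    unfolding mvps_nth_mult mvps_const_def mvps_nth_Abs_mvps by (intro sum.cong) auto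
  then show ?thesis by simp
qed

lemma mvps_const_one: "mvps_const 1 = 1"
  by (simp add: mvps_const_def one_mvps_def)

lemma mvps_const_mult: "mvps_const (a * b) = mvps_const a * mvps_const b"
  by (rule mvps_eqI, subst mvps_nth_const_mult) (simp add: mvps_const_def)

lemma mvps_const_power: "mvps_const (a ^ j) = mvps_const a ^ j"
  by (induction j) (simp_all add: mvps_const_one mvps_const_mult)

lemma mvps_const_sum: "mvps_const (sum f S) = (\<Sum>x\<in>S. mvps_const (f x))"
  by (rule mvps_eqI) (simp add: mvps_nth_sum mvps_const_def)

text \<open>Lets a q-integer be divided out. Constants act coefficientwise, so it suffices that the
  coefficient ring is a domain.\<close>

lemma mvps_const_mult_left_cancel:
  fixes c :: "'a::idom"
  assumes "c \<noteq> 0" "mvps_const c * f = mvps_const c * g"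
  shows "f = g"
proof (rule mvps_eqI)
  fix M
  have "c * mvps_nth f M = c * mvps_nth g M"
    using arg_cong[OF assms(2), of "\<lambda>h. mvps_nth h M"] by simp
  with \<open>c \<noteq> 0\<close> show "mvps_nth f M = mvps_nth g M" by simp
qed

lemma qint_0 [simp]: "qint q 0 = 0"
  and qint_Suc: "qint q (Suc k) = qint q k + q ^ k"
  by (simp_all add: qint_def)

lemma qint_add: "qint q (a + b) = qint q a + q ^ a * qint q b"
  by (induction b) (simp_all add: qint_Suc algebra_simps power_add)

lemma qint_Suc_left: "qint q (Suc k) = 1 + q * qint q k"
  using qint_add[of q 1 k] by (simp add: qint_Suc)

lemma qint_1 [simp]: "qint q (Suc 0) = 1"
  by (simp add: qint_Suc)

lemma qfact_0 [simp]: "qfact q 0 = 1"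
  and qfact_Suc: "qfact q (Suc k) = qint q (Suc k) * qfact q k"
  by (simp_all add: qfact_def mult.commute)

lemma qint_qvar: "qint qvar k = mvps_const (qint (monom 1 1) k)"
  by (simp add: qint_def qvar_def mvps_const_sum mvps_const_power)

lemma qfact_qvar: "qfact qvar k = mvps_const (qfact (monom 1 1) k)"
  by (induction k) (simp_all add: mvps_const_one qfact_Suc qint_qvar mvps_const_mult)

lemma qint_monom_nonzero:
  assumes "k > 0"
  shows "qint (monom 1 1 :: int poly) k \<noteq> 0"
proof
  assume "qint (monom 1 1 :: int poly) k = 0"
  \<comment> \<open>At q = 1 the q-integer takes the value k.\<close>
  then have "poly (qint (monom 1 1 :: int poly) k) 1 = 0" by simp
  then show False using assms by (simp add: qint_def poly_sum poly_monom)
qed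

lemma qint_qvar_left_cancel:
  assumes "k > 0" "qint qvar k * f = qint qvar k * g"
  shows "f = g"
  using mvps_const_mult_left_cancel[OF qint_monom_nonzero[OF assms(1)]] assms(2)
  by (simp add: qint_qvar)

text \<open>The characteristic roots are 1 and q: each consecutive difference is q times the
  previous one, and the geometric sum of j of them is the q-integer.\<close>

lemma qint_recurrence_solution:
  fixes q :: "'a::comm_ring_1"
  assumes "\<And>i. i + 2 \<le> N \<Longrightarrow> b (i + 2) + q * b i = (1 + q) * b (i + 1)" "j \<le> N"
  shows "b j = b 0 + qint q j * (b 1 - b 0)"
  using assms(2)
proof (induction j rule: less_induct)
  case (less j)
  consider "j = 0" | "j = 1" | i where "j = i + 2"
    by (metis One_nat_def add_2_eq_Suc' nat.exhaust)
  then show ?case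
  proof cases
    case 3
    have "b j = (1 + q) * b (i + 1) - q * b i"
      using assms(1)[of i] less.prems 3 by (simp add: algebra_simps)
    also have "\<dots> = (1 + q) * (b 0 + qint q (i + 1) * (b 1 - b 0)) - q * (b 0 + qint q i * (b 1 - b 0))"
      using less.IH[of i] less.IH[of "i + 1"] less.prems 3 by simp
    also have "\<dots> = b 0 + ((1 + q) * qint q (i + 1) - q * qint q i) * (b 1 - b 0)"
      by (simp add: algebra_simps)
    also have "(1 + q) * qint q (i + 1) - q * qint q i = qint q j"
      using 3 by (simp add: qint_Suc algebra_simps)
    finally show ?thesis .
  qed simp_all
qed

section \<open>The modular law\<close>

definition simple_graph :: "nat_graph \<Rightarrow> bool" where
  "simple_graph G \<longleftrightarrow> finite (verts G) \<and>
     (\<forall>e\<in>edges G. \<exists>u v. e = {u, v} \<and> u < v \<and> u \<in> verts G \<and> v \<in> verts G)"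

text \<open>Properness is not imposed here; improper colorings get weight 0 instead. All graphs on
  the same vertices thus share one index set and can be compared weight by weight.\<close>

definition colorings :: "nat set \<Rightarrow> nat multiset \<Rightarrow> (nat \<Rightarrow> nat) set" where
  "colorings V M = {\<kappa> \<in> V \<rightarrow>\<^sub>E {0<..}. image_mset \<kappa> (mset_set V) = M}"

text \<open>The ascent statistic in multiplicative form, so that adding an edge to a graph
  multiplies each summand by a single factor.\<close>

definition edge_weight :: "(nat \<Rightarrow> nat) \<Rightarrow> nat set \<Rightarrow> int poly" where
  "edge_weight \<kappa> e =
     (if \<kappa> (Min e) = \<kappa> (Max e) then 0 else if \<kappa> (Min e) < \<kappa> (Max e) then monom 1 1 else 1)"

lemma edge_weight_pair:
  "u < v \<Longrightarrow> edge_weight \<kappa> {u, v} =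
     (if \<kappa> u = \<kappa> v then 0 else if \<kappa> u < \<kappa> v then monom 1 1 else 1)"
  by (simp add: edge_weight_def max_def min_def)

lemma finite_colorings:
  assumes "finite V"
  shows "finite (colorings V M)"
proof -
  have "colorings V M \<subseteq> V \<rightarrow>\<^sub>E set_mset M"
  proof
    fix \<kappa> assume \<kappa>: "\<kappa> \<in> colorings V M"
    then have "set_mset M = \<kappa> ` V" using assms by (auto simp: colorings_def)
    with \<kappa> show "\<kappa> \<in> V \<rightarrow>\<^sub>E set_mset M" by (auto simp: colorings_def PiE_iff)
  qed
  then show ?thesis
    by (rule finite_subset) (intro finite_PiE assms finite_set_mset)
qed

lemma simple_graph_finite_edges:
  assumes "simple_graph G"
  shows "finite (edges G)"
proof -
  have "edges G \<subseteq> Pow (verts G)"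
    using assms by (force simp: simple_graph_def)
  then show ?thesis using assms by (meson finite_Pow_iff finite_subset simple_graph_def)
qed

text \<open>One violated edge makes the whole product 0, and otherwise the factors q count the
  ascents. The modular law, disjoint unions and cliques are all computed in this form.\<close>

lemma chromatic_qsym_nth:
  assumes "simple_graph G"
  shows "mvps_nth (chromatic_qsym G) M = (\<Sum>\<kappa>\<in>colorings (verts G) M. \<Prod>e\<in>edges G. edge_weight \<kappa> e)"
proof -
  have fin: "finite (edges G)" by (rule simple_graph_finite_edges[OF assms])
  have weight: "(\<Prod>e\<in>edges G. edge_weight \<kappa> e) =
      (if \<forall>u v. {u, v} \<in> edges G \<longrightarrow> \<kappa> u \<noteq> \<kappa> v then monom 1 (asc G \<kappa>) else 0)" for \<kappa>
  proof (cases "\<forall>u v. {u, v} \<in> edges G \<longrightarrow> \<kappa> u \<noteq> \<kappa> v")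
    case True
    have "(\<Prod>e\<in>edges G. edge_weight \<kappa> e) =
        (\<Prod>e\<in>edges G. if \<exists>u v. e = {u, v} \<and> u < v \<and> \<kappa> u < \<kappa> v then monom 1 1 else 1)"
    proof (rule prod.cong)
      fix e assume "e \<in> edges G"
      then obtain u v where e: "e = {u, v}" "u < v" using assms by (auto simp: simple_graph_def)
      then have "(\<exists>u v. e = {u, v} \<and> u < v \<and> \<kappa> u < \<kappa> v) \<longleftrightarrow> \<kappa> u < \<kappa> v"
        by (auto simp: doubleton_eq_iff)
      then show "edge_weight \<kappa> e = (if \<exists>u v. e = {u, v} \<and> u < v \<and> \<kappa> u < \<kappa> v then monom 1 1 else 1)"
        using True e \<open>e \<in> edges G\<close> by (simp add: edge_weight_pair)
    qed simp
    also have "\<dots> = monom 1 1 ^ asc G \<kappa>"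
      using fin by (simp add: prod.If_cases asc_def Int_def)
    also have "\<dots> = monom 1 (asc G \<kappa>)" by (simp add: monom_power)
    finally show ?thesis using True by simp
  next
    case False
    then obtain u v where uv: "{u, v} \<in> edges G" "\<kappa> u = \<kappa> v" by auto
    then obtain u' v' where "{u, v} = {u', v'}" "u' < v'" using assms unfolding simple_graph_def by blast
    with uv have "edge_weight \<kappa> {u, v} = 0"
      using edge_weight_pair[of u v \<kappa>] edge_weight_pair[of v u \<kappa>]
      by (auto simp: doubleton_eq_iff insert_commute)
    with uv fin have "(\<Prod>e\<in>edges G. edge_weight \<kappa> e) = 0" by (meson prod_zero)
    with False show ?thesis by auto
  qed
  have "(\<Sum>\<kappa>\<in>colorings (verts G) M. \<Prod>e\<in>edges G. edge_weight \<kappa> e) =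
      (\<Sum>\<kappa> | \<kappa> \<in> colorings (verts G) M \<and> (\<forall>u v. {u, v} \<in> edges G \<longrightarrow> \<kappa> u \<noteq> \<kappa> v). monom 1 (asc G \<kappa>))"
    unfolding weight using assms
    by (subst sum.inter_filter) (simp_all add: finite_colorings simple_graph_def)
  also have "\<dots> = mvps_nth (chromatic_qsym G) M"
    by (simp add: chromatic_qsym_def proper_colorings_def coloring_monom_def colorings_def conj_ac)
  finally show ?thesis ..
qed

text \<open>
  Exchanging the colors of \<open>u\<close> and \<open>Suc u\<close> turns the contribution of a coloring to the difference of
  both sides into its negative.
\<close>

lemma chromatic_qsym_modular:
  assumes G: "simple_graph (V, E)" and V: "r \<in> V" "u \<in> V" "Suc u \<in> V" and "r < u"
    and E: "{u, Suc u} \<in> E" "{r, u} \<notin> E" "{r, Suc u} \<notin> E"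
    and twins: "\<And>x. x \<noteq> u \<Longrightarrow> x \<noteq> Suc u \<Longrightarrow> {x, u} \<in> E \<longleftrightarrow> {x, Suc u} \<in> E"
  shows "chromatic_qsym (V, insert {r, Suc u} (insert {r, u} E)) + qvar * chromatic_qsym (V, E) =
         (1 + qvar) * chromatic_qsym (V, insert {r, u} E)"
proof (rule mvps_eqI)
  fix M
  define q :: "int poly" where "q = monom 1 1"
  define \<sigma> where "\<sigma> = transpose u (Suc u)"
  have \<sigma>\<sigma>: "\<sigma> (\<sigma> x) = x" for x by (simp add: \<sigma>_def)
  have [simp]: "\<sigma> u = Suc u" "\<sigma> (Suc u) = u" "\<sigma> r = r"
    using \<open>r < u\<close> by (auto simp: \<sigma>_def transpose_def)
  have fin: "finite V" "finite E"
    using G simple_graph_finite_edges[OF G] by (auto simp: simple_graph_def verts_def edges_def)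
  \<comment> \<open>The edge between the twins is set aside: it is the only edge of \<open>E\<close>
    whose ends are put in the opposite order by \<open>\<sigma>\<close>, while the weights of the
    others are merely permuted.\<close>
  define E' where "E' = E - {{u, Suc u}}"
  have E': "E = insert {u, Suc u} E'" "{u, Suc u} \<notin> E'" "finite E'" using E fin by (auto simp: E'_def)
  have edge: "\<exists>x y. e = {x, y} \<and> x < y \<and> (x, y) \<noteq> (u, Suc u)" if "e \<in> E'" for e
    using that G by (fastforce simp: E'_def simple_graph_def edges_def)
  define R where "R \<kappa> = (\<Prod>e\<in>E'. edge_weight \<kappa> e)" for \<kappa>
  have \<sigma>E': "\<sigma> ` e \<in> E'" if e: "e \<in> E'" for e
  proof -
    from edge[OF e] obtain x y where xy: "e = {x, y}" "x < y" "(x, y) \<noteq> (u, Suc u)" by blast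
    have "e \<in> E" using e by (simp add: E')
    consider "x = u" | "x = Suc u" | "y = u" | "y = Suc u" | "\<sigma> x = x" "\<sigma> y = y"
      by (metis \<sigma>_def transpose_apply_other)
    then have "\<sigma> ` e \<in> E"
    proof cases
      case 1
      then have "y \<noteq> u" "y \<noteq> Suc u" "\<sigma> y = y" using xy by (auto simp: \<sigma>_def transpose_def)
      with twins[of y] \<open>e \<in> E\<close> 1 xy show ?thesis by (simp add: insert_commute)
    next
      case 2
      then have "y \<noteq> u" "y \<noteq> Suc u" "\<sigma> y = y" using xy by (auto simp: \<sigma>_def transpose_def)
      with twins[of y] \<open>e \<in> E\<close> 2 xy show ?thesis by (simp add: insert_commute)
    next
      case 3
      then have "x \<noteq> u" "x \<noteq> Suc u" "\<sigma> x = x" using xy by (auto simp: \<sigma>_def transpose_def)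
      with twins[of x] \<open>e \<in> E\<close> 3 xy show ?thesis by simp
    next
      case 4
      then have "x \<noteq> u" "x \<noteq> Suc u" "\<sigma> x = x" using xy by (auto simp: \<sigma>_def transpose_def)
      with twins[of x] \<open>e \<in> E\<close> 4 xy show ?thesis by simp
    next
      case 5
      with \<open>e \<in> E\<close> xy show ?thesis by simp
    qed
    moreover have "\<sigma> ` e \<noteq> {u, Suc u}"
    proof
      assume "\<sigma> ` e = {u, Suc u}"
      then have "\<sigma> ` \<sigma> ` e = \<sigma> ` {u, Suc u}" by simp
      then have "e = {u, Suc u}" by (simp add: image_image \<sigma>\<sigma> insert_commute)
      with e show False by (simp add: E'_def)
    qed
    ultimately show ?thesis by (simp add: E'_def)
  qed
  have R\<sigma>: "R (\<kappa> \<circ> \<sigma>) = R \<kappa>" for \<kappa>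
    unfolding R_def
  proof (rule prod.reindex_bij_witness[where i = "image \<sigma>" and j = "image \<sigma>"])
    fix e assume e: "e \<in> E'"
    from edge[OF e] obtain x y where xy: "e = {x, y}" "x < y" "(x, y) \<noteq> (u, Suc u)" by blast
    \<comment> \<open>As \<open>u\<close> and \<open>Suc u\<close> are consecutive, no other pair
      changes its order.\<close>
    then have "\<sigma> x < \<sigma> y" by (auto simp: \<sigma>_def transpose_def)
    with xy show "edge_weight \<kappa> (\<sigma> ` e) = edge_weight (\<kappa> \<circ> \<sigma>) e"
      by (simp add: edge_weight_pair)
  qed (simp_all add: image_image \<sigma>\<sigma> \<sigma>E')
  define w where "w \<kappa> x = (if \<kappa> r = \<kappa> x then 0 else if \<kappa> r < \<kappa> x then q else 1)" for \<kappa> :: "nat \<Rightarrow> nat" and x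
  define w' where "w' \<kappa> = edge_weight \<kappa> {u, Suc u}" for \<kappa>
  have w'_eq: "w' \<kappa> = (if \<kappa> u = \<kappa> (Suc u) then 0 else if \<kappa> u < \<kappa> (Suc u) then q else 1)" for \<kappa>
    by (simp add: w'_def edge_weight_pair q_def)
  define F where "F \<kappa> = R \<kappa> * (w' \<kappa> * (w \<kappa> u * w \<kappa> (Suc u) + q - (1 + q) * w \<kappa> u))" for \<kappa>
  have F\<sigma>: "F (\<kappa> \<circ> \<sigma>) = - F \<kappa>" for \<kappa>
  proof -
    \<comment> \<open>If \<open>\<kappa> u < \<kappa> (Suc u)\<close>, left side minus right side is
      \<open>(1 + q) * (w \<kappa> u - 1) * (w \<kappa> (Suc u) - q)\<close>. This vanishes, as the
      color of \<open>r\<close> is above that of \<open>u\<close> or below that of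
      \<open>Suc u\<close>. The opposite order is symmetric, and for equal colors both factors
      \<open>w'\<close> are 0.\<close>
    have "w' \<kappa> * (w \<kappa> u * w \<kappa> (Suc u) + q - (1 + q) * w \<kappa> u) =
        - (w' (\<kappa> \<circ> \<sigma>) * (w \<kappa> (Suc u) * w \<kappa> u + q - (1 + q) * w \<kappa> (Suc u)))"
      by (cases "\<kappa> u" "\<kappa> (Suc u)" rule: linorder_cases;
          cases "\<kappa> r" "\<kappa> u" rule: linorder_cases;
          cases "\<kappa> r" "\<kappa> (Suc u)" rule: linorder_cases)
        (simp_all add: w'_eq w_def algebra_simps)
    moreover have "w (\<kappa> \<circ> \<sigma>) u = w \<kappa> (Suc u)" "w (\<kappa> \<circ> \<sigma>) (Suc u) = w \<kappa> u"
      by (simp_all add: w_def)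
    ultimately show ?thesis
      by (simp only: F_def R\<sigma> mult_minus_right minus_minus)
  qed
  have "(\<Sum>\<kappa>\<in>colorings V M. F \<kappa>) = (\<Sum>\<kappa>\<in>colorings V M. F (\<kappa> \<circ> \<sigma>))"
  proof (rule sum.reindex_bij_witness[where i = "\<lambda>\<kappa>. \<kappa> \<circ> \<sigma>" and j = "\<lambda>\<kappa>. \<kappa> \<circ> \<sigma>"])
    have \<sigma>V: "\<sigma> x \<in> V \<longleftrightarrow> x \<in> V" for x using V by (auto simp: \<sigma>_def transpose_def)
    have "\<sigma> ` V = V" using V by (simp add: \<sigma>_def)
    moreover have "inj_on \<sigma> V" by (simp add: \<sigma>_def)
    ultimately have "image_mset \<sigma> (mset_set V) = mset_set V" by (simp add: image_mset_mset_set)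
    then have "image_mset (\<kappa> \<circ> \<sigma>) (mset_set V) = image_mset \<kappa> (mset_set V)" for \<kappa>
      by (metis multiset.map_comp)
    then show \<sigma>_colorings: "\<kappa> \<circ> \<sigma> \<in> colorings V M" if "\<kappa> \<in> colorings V M" for \<kappa>
      using that \<sigma>V unfolding colorings_def by (auto simp: PiE_iff extensional_def)
    show "\<kappa> \<circ> \<sigma> \<in> colorings V M" if "\<kappa> \<in> colorings V M" for \<kappa>
      using that by (rule \<sigma>_colorings)
    have \<sigma>_invol: "\<kappa> \<circ> \<sigma> \<circ> \<sigma> = \<kappa>" for \<kappa> :: "nat \<Rightarrow> nat"
      by (simp add: fun_eq_iff \<sigma>\<sigma>)
    then show "\<kappa> \<circ> \<sigma> \<circ> \<sigma> = \<kappa>" "\<kappa> \<circ> \<sigma> \<circ> \<sigma> = \<kappa>" "F (\<kappa> \<circ> \<sigma> \<circ> \<sigma>) = F \<kappa>" for \<kappa>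
      by simp_all
  qed
  also have "\<dots> = - (\<Sum>\<kappa>\<in>colorings V M. F \<kappa>)" by (simp add: F\<sigma> sum_negf)
  finally have F0: "(\<Sum>\<kappa>\<in>colorings V M. F \<kappa>) = 0" by simp
  have G': "simple_graph (V, insert {r, u} E)" "simple_graph (V, insert {r, Suc u} (insert {r, u} E))"
    using G V \<open>r < u\<close> by (auto simp: simple_graph_def verts_def edges_def intro: less_SucI)
  note nth = chromatic_qsym_nth[OF G] chromatic_qsym_nth[OF G'(1)] chromatic_qsym_nth[OF G'(2)]
  have ru: "edge_weight \<kappa> {r, u} = w \<kappa> u" "edge_weight \<kappa> {r, Suc u} = w \<kappa> (Suc u)" for \<kappa>
    using \<open>r < u\<close> by (simp_all add: edge_weight_pair w_def q_def)
  have prods: "(\<Prod>e\<in>E. edge_weight \<kappa> e) = R \<kappa> * w' \<kappa>"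
    "(\<Prod>e\<in>insert {r, u} E. edge_weight \<kappa> e) = R \<kappa> * w' \<kappa> * w \<kappa> u"
    "(\<Prod>e\<in>insert {r, Suc u} (insert {r, u} E). edge_weight \<kappa> e) =
      R \<kappa> * w' \<kappa> * w \<kappa> u * w \<kappa> (Suc u)" for \<kappa>
  proof -
    show 1: "(\<Prod>e\<in>E. edge_weight \<kappa> e) = R \<kappa> * w' \<kappa>" using E'
      by (simp add: R_def w'_def mult.commute)
    show 2: "(\<Prod>e\<in>insert {r, u} E. edge_weight \<kappa> e) = R \<kappa> * w' \<kappa> * w \<kappa> u"
      using E fin 1 by (simp add: ru mult.commute)
    show "(\<Prod>e\<in>insert {r, Suc u} (insert {r, u} E). edge_weight \<kappa> e) =
        R \<kappa> * w' \<kappa> * w \<kappa> u * w \<kappa> (Suc u)"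
      using E fin 2 by (subst prod.insert) (auto simp: ru mult.commute doubleton_eq_iff)
  qed
  have "mvps_nth (chromatic_qsym (V, insert {r, Suc u} (insert {r, u} E))) M
      + q * mvps_nth (chromatic_qsym (V, E)) M
      - (1 + q) * mvps_nth (chromatic_qsym (V, insert {r, u} E)) M = (\<Sum>\<kappa>\<in>colorings V M. F \<kappa>)"
    unfolding nth verts_def edges_def fst_conv snd_conv prods sum_distrib_left
      sum.distrib[symmetric] sum_subtractf[symmetric] F_def
    by (intro sum.cong refl) (simp add: algebra_simps)
  with F0 show "mvps_nth (chromatic_qsym (V, insert {r, Suc u} (insert {r, u} E)) + qvar * chromatic_qsym (V, E)) M =
      mvps_nth ((1 + qvar) * chromatic_qsym (V, insert {r, u} E)) M"
    by (simp add: qvar_def q_def distrib_right)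
qed

section \<open>Disjoint unions and cliques\<close>

lemma simple_graph_edgeE:
  assumes "simple_graph (V, E)" "e \<in> E"
  obtains u v where "e = {u, v}" "u < v" "u \<in> V" "v \<in> V"
  using assms by (auto simp: simple_graph_def verts_def edges_def)

lemma edge_weight_cong:
  assumes "simple_graph (V, E)" "e \<in> E" "\<And>x. x \<in> V \<Longrightarrow> \<kappa> x = \<kappa>' x"
  shows "edge_weight \<kappa> e = edge_weight \<kappa>' e"
proof -
  obtain u v where "e = {u, v}" "u < v" "u \<in> V" "v \<in> V"
    using assms(1,2) by (auto simp: simple_graph_def verts_def edges_def)
  with assms(3) show ?thesis by (simp add: edge_weight_pair)
qed

text \<open>A coloring of the union is a pair of colorings whose monomials multiply; sorting the
  pairs by the monomial \<open>A\<close> of the first gives the Cauchy product of the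
  series.\<close>

lemma chromatic_qsym_disjoint_union:
  assumes G: "simple_graph (V\<^sub>1, E\<^sub>1)" "simple_graph (V\<^sub>2, E\<^sub>2)" and V: "V\<^sub>1 \<inter> V\<^sub>2 = {}"
  shows "chromatic_qsym (V\<^sub>1 \<union> V\<^sub>2, E\<^sub>1 \<union> E\<^sub>2) = chromatic_qsym (V\<^sub>1, E\<^sub>1) * chromatic_qsym (V\<^sub>2, E\<^sub>2)"
proof (rule mvps_eqI)
  fix M
  define W where "W E \<kappa> = (\<Prod>e\<in>E. edge_weight \<kappa> e)" for E \<kappa>
  have fin: "finite V\<^sub>1" "finite V\<^sub>2" "finite E\<^sub>1" "finite E\<^sub>2"
    using G simple_graph_finite_edges[OF G(1)] simple_graph_finite_edges[OF G(2)]
    by (auto simp: simple_graph_def verts_def edges_def)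
  have G12: "simple_graph (V\<^sub>1 \<union> V\<^sub>2, E\<^sub>1 \<union> E\<^sub>2)"
    using G unfolding simple_graph_def verts_def edges_def fst_conv snd_conv Ball_def
    by (metis Un_iff finite_Un)
  have E: "E\<^sub>1 \<inter> E\<^sub>2 = {}"
  proof (rule ccontr)
    assume "E\<^sub>1 \<inter> E\<^sub>2 \<noteq> {}"
    then obtain e where e: "e \<in> E\<^sub>1" "e \<in> E\<^sub>2" by blast
    obtain u v where "e = {u, v}" "u \<in> V\<^sub>1" using simple_graph_edgeE[OF G(1) e(1)] by blast
    moreover obtain u' v' where "e = {u', v'}" "u' \<in> V\<^sub>2" "v' \<in> V\<^sub>2"
      using simple_graph_edgeE[OF G(2) e(2)] by blast
    ultimately show False using V by (auto simp: doubleton_eq_iff)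
  qed
  have W_restrict: "W E (restrict \<kappa> V) = W E \<kappa>" if "simple_graph (V, E)" for V E \<kappa>
    unfolding W_def by (intro prod.cong edge_weight_cong[OF that]) auto
  have W_Un: "W (E\<^sub>1 \<union> E\<^sub>2) \<kappa> = W E\<^sub>1 \<kappa> * W E\<^sub>2 \<kappa>" for \<kappa>
    unfolding W_def using E fin by (simp add: prod.union_disjoint)
  have mset_Un: "mset_set (V\<^sub>1 \<union> V\<^sub>2) = mset_set V\<^sub>1 + mset_set V\<^sub>2"
    using V fin by (simp add: mset_set_Union)
  \<comment> \<open>\<open>A\<close> is determined by \<open>\<kappa>\<^sub>1\<close>, so
    \<open>join\<close> may ignore it; the triple carries it to match the index set of the Cauchy
    product.\<close>
  define join where "join = (\<lambda>(A::nat multiset, \<kappa>\<^sub>1::nat \<Rightarrow> nat, \<kappa>\<^sub>2::nat \<Rightarrow> nat) x. if x \<in> V\<^sub>1 then \<kappa>\<^sub>1 x else \<kappa>\<^sub>2 x)"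
  define split where "split \<kappa> = (image_mset \<kappa> (mset_set V\<^sub>1), restrict \<kappa> V\<^sub>1, restrict \<kappa> V\<^sub>2)"
    for \<kappa> :: "nat \<Rightarrow> nat"
  have cong: "image_mset f (mset_set V) = image_mset g (mset_set V)"
    if "\<And>x. x \<in> V \<Longrightarrow> f x = g x" "finite V" for f g :: "nat \<Rightarrow> nat" and V
    using that by (intro image_mset_cong) simp
  have notin: "x \<notin> V\<^sub>1" if "x \<in> V\<^sub>2" for x using that V by blast
  have join_mset: "image_mset (join (A, \<kappa>\<^sub>1, \<kappa>\<^sub>2)) (mset_set V\<^sub>1) = image_mset \<kappa>\<^sub>1 (mset_set V\<^sub>1)"
    "image_mset (join (A, \<kappa>\<^sub>1, \<kappa>\<^sub>2)) (mset_set V\<^sub>2) = image_mset \<kappa>\<^sub>2 (mset_set V\<^sub>2)" for A \<kappa>\<^sub>1 \<kappa>\<^sub>2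
    using notin by (auto intro!: cong simp: join_def fin)
  have restrict_mset: "image_mset (restrict \<kappa> V) (mset_set V) = image_mset \<kappa> (mset_set V)"
    if "finite V" for \<kappa> :: "nat \<Rightarrow> nat" and V
    using that by (intro cong) auto
  have "mvps_nth (chromatic_qsym (V\<^sub>1 \<union> V\<^sub>2, E\<^sub>1 \<union> E\<^sub>2)) M = (\<Sum>\<kappa>\<in>colorings (V\<^sub>1 \<union> V\<^sub>2) M. W (E\<^sub>1 \<union> E\<^sub>2) \<kappa>)"
    using chromatic_qsym_nth[OF G12] by (simp add: W_def verts_def edges_def)
  also have "\<dots> = (\<Sum>(A, \<kappa>\<^sub>1, \<kappa>\<^sub>2)\<in>(SIGMA A:{A. A \<subseteq># M}. colorings V\<^sub>1 A \<times> colorings V\<^sub>2 (M - A)). W E\<^sub>1 \<kappa>\<^sub>1 * W E\<^sub>2 \<kappa>\<^sub>2)"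
  proof (rule sum.reindex_bij_witness[where i = join and j = split], goal_cases)
    case (1 \<kappa>)
    then have "\<kappa> x = undefined" if "x \<notin> V\<^sub>1" "x \<notin> V\<^sub>2" for x
      using that by (auto simp: colorings_def PiE_def extensional_def)
    then show ?case by (auto simp: split_def join_def fun_eq_iff)
  next
    case (2 \<kappa>)
    then have "M = image_mset \<kappa> (mset_set V\<^sub>1) + image_mset \<kappa> (mset_set V\<^sub>2)"
      by (simp add: colorings_def mset_Un)
    with 2 show ?case
      by (auto simp: split_def colorings_def restrict_mset fin PiE_iff)
  next
    case (3 a)
    then obtain A \<kappa>\<^sub>1 \<kappa>\<^sub>2 where a: "a = (A, \<kappa>\<^sub>1, \<kappa>\<^sub>2)" "\<kappa>\<^sub>1 \<in> colorings V\<^sub>1 A" "\<kappa>\<^sub>2 \<in> colorings V\<^sub>2 (M - A)"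
      by auto
    then have "restrict (join a) V\<^sub>1 = \<kappa>\<^sub>1" "restrict (join a) V\<^sub>2 = \<kappa>\<^sub>2"
      using notin by (auto simp: join_def colorings_def PiE_iff extensional_def fun_eq_iff)
    with a show ?case by (auto simp: split_def join_mset colorings_def)
  next
    case (4 a)
    then obtain A \<kappa>\<^sub>1 \<kappa>\<^sub>2 where a: "a = (A, \<kappa>\<^sub>1, \<kappa>\<^sub>2)" "A \<subseteq># M" "\<kappa>\<^sub>1 \<in> colorings V\<^sub>1 A" "\<kappa>\<^sub>2 \<in> colorings V\<^sub>2 (M - A)"
      by auto
    then have "image_mset (join a) (mset_set (V\<^sub>1 \<union> V\<^sub>2)) = M"
      by (simp add: mset_Un join_mset) (simp add: colorings_def)
    moreover have "join a \<in> V\<^sub>1 \<union> V\<^sub>2 \<rightarrow>\<^sub>E {0<..}"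
      using a by (auto simp: join_def colorings_def PiE_iff extensional_def)
    ultimately show ?case by (simp add: colorings_def)
  next
    case (5 \<kappa>)
    show ?case by (simp add: split_def W_Un W_restrict G)
  qed
  also have "\<dots> = (\<Sum>A | A \<subseteq># M. \<Sum>(\<kappa>\<^sub>1, \<kappa>\<^sub>2)\<in>colorings V\<^sub>1 A \<times> colorings V\<^sub>2 (M - A). W E\<^sub>1 \<kappa>\<^sub>1 * W E\<^sub>2 \<kappa>\<^sub>2)"
    by (subst sum.Sigma) (auto simp: finite_colorings fin)
  also have "\<dots> = (\<Sum>A | A \<subseteq># M. (\<Sum>\<kappa>\<^sub>1\<in>colorings V\<^sub>1 A. W E\<^sub>1 \<kappa>\<^sub>1) * (\<Sum>\<kappa>\<^sub>2\<in>colorings V\<^sub>2 (M - A). W E\<^sub>2 \<kappa>\<^sub>2))"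
    by (simp add: sum_product sum.cartesian_product)
  also have "\<dots> = mvps_nth (chromatic_qsym (V\<^sub>1, E\<^sub>1) * chromatic_qsym (V\<^sub>2, E\<^sub>2)) M"
    using chromatic_qsym_nth[OF G(1)] chromatic_qsym_nth[OF G(2)]
    by (simp add: mvps_nth_mult W_def verts_def edges_def)
  finally show "mvps_nth (chromatic_qsym (V\<^sub>1 \<union> V\<^sub>2, E\<^sub>1 \<union> E\<^sub>2)) M = \<dots>" .
qed

section \<open>Cliques and q-factorials\<close>

definition clique :: "nat set \<Rightarrow> nat_graph" where
  "clique V = (V, {{u, v} | u v. u \<in> V \<and> v \<in> V \<and> u \<noteq> v})"

lemma verts_clique [simp]: "verts (clique V) = V"
  by (simp add: clique_def verts_def)

lemma edges_clique: "edges (clique V) = {{u, v} | u v. u \<in> V \<and> v \<in> V \<and> u \<noteq> v}"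
  by (simp add: clique_def edges_def)

lemma simple_graph_clique: "finite V \<Longrightarrow> simple_graph (clique V)"
  unfolding simple_graph_def edges_clique verts_clique
  by (auto, metis insert_commute linorder_neqE_nat)

lemma edges_clique_insert:
  "v \<notin> V \<Longrightarrow> edges (clique (insert v V)) = (\<lambda>a. {a, v}) ` V \<union> edges (clique V)"
  by (auto simp: edges_clique doubleton_eq_iff)

text \<open>The number of smaller elements takes each value from 0 to \<open>card S - 1\<close>
  exactly once.\<close>

lemma sum_power_rank:
  fixes S :: "'b::linorder set"
  assumes "finite S"
  shows "(\<Sum>s\<in>S. q ^ card {x \<in> S. x < s}) = qint q (card S)"
  using assms
proof (induction S rule: finite_linorder_max_induct)
  case (insert b A)
  then have b: "b \<notin> A" by auto
  have "{x \<in> insert b A. x < b} = A" using insert by auto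
  moreover have "{x \<in> insert b A. x < s} = {x \<in> A. x < s}" if "s \<in> A" for s
    using insert that by (auto dest: less_asym)
  ultimately show ?case using insert b by (simp add: qint_Suc add.commute)
qed simp

text \<open>This is the Mahonian distribution: the bijections onto \<open>S\<close> are
  permutations, and ascents are their non-inversions. Color s at the largest vertex contributes q to
  the rank of s, so \<open>sum_power_rank\<close> yields the next factor of the q-factorial.\<close>

lemma sum_edge_weight_clique:
  assumes "finite V" "finite S" "card V = card S"
  shows "(\<Sum>\<kappa> | \<kappa> \<in> V \<rightarrow>\<^sub>E S \<and> bij_betw \<kappa> V S. \<Prod>e\<in>edges (clique V). edge_weight \<kappa> e) =
    qfact (monom 1 1) (card V)"
  using assms
proof (induction V arbitrary: S rule: finite_linorder_max_induct)
  case empty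
  then have "{\<kappa>. \<kappa> \<in> ({} :: nat set) \<rightarrow>\<^sub>E S \<and> bij_betw \<kappa> {} S} = {\<lambda>_. undefined}"
    by (auto simp: bij_betw_def)
  then show ?case by (simp add: edges_clique)
next
  case (insert v V)
  define W where "W V \<kappa> = (\<Prod>e\<in>edges (clique V). edge_weight \<kappa> e)" for V \<kappa>
  define B where "B V S = {\<kappa>. \<kappa> \<in> V \<rightarrow>\<^sub>E S \<and> bij_betw \<kappa> V S}" for V S :: "nat set"
  have v: "v \<notin> V" using insert by auto
  have "card S = Suc (card V)" using insert v by simp
  have finB: "finite (B V T)" if "finite T" for T
    using finite_PiE[of V "\<lambda>_. T"] insert(1) that by (auto simp: B_def intro: rev_finite_subset)
  have W_insert: "W (insert v V) \<kappa> = monom 1 1 ^ card {x \<in> S. x < \<kappa> v} * W V (restrict \<kappa> V)"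
    if "\<kappa> \<in> B (insert v V) S" for \<kappa>
  proof -
    from that have inj: "inj_on \<kappa> (insert v V)" and S: "\<kappa> ` insert v V = S"
      by (auto simp: B_def bij_betw_def)
    have "finite (edges (clique V))"
      using insert by (intro simple_graph_finite_edges simple_graph_clique)
    moreover have "(\<lambda>a. {a, v}) ` V \<inter> edges (clique V) = {}"
      using v by (auto simp: edges_clique doubleton_eq_iff)
    moreover have "inj_on (\<lambda>a. {a, v}) V" by (auto simp: inj_on_def doubleton_eq_iff)
    ultimately have "W (insert v V) \<kappa> = (\<Prod>a\<in>V. edge_weight \<kappa> {a, v}) * W V \<kappa>"
      using insert(1) by (simp add: W_def edges_clique_insert[OF v] prod.union_disjoint prod.reindex)
    \<comment> \<open>\<open>v\<close> exceeds all of \<open>V\<close>, so its edges are ascents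
      exactly at the vertices of smaller color.\<close>
    also have "(\<Prod>a\<in>V. edge_weight \<kappa> {a, v}) = (\<Prod>a\<in>V. if \<kappa> a < \<kappa> v then monom 1 1 else 1)"
      using insert(2) inj v by (intro prod.cong) (auto simp: edge_weight_pair inj_on_def)
    also have "\<dots> = monom 1 1 ^ card {a \<in> V. \<kappa> a < \<kappa> v}"
      using insert(1) by (simp add: prod.If_cases Int_def)
    also have "card {a \<in> V. \<kappa> a < \<kappa> v} = card {x \<in> S. x < \<kappa> v}"
    proof (rule bij_betw_same_card)
      have "\<kappa> ` {a \<in> V. \<kappa> a < \<kappa> v} = {x \<in> S. x < \<kappa> v}" unfolding S[symmetric] by auto
      then show "bij_betw \<kappa> {a \<in> V. \<kappa> a < \<kappa> v} {x \<in> S. x < \<kappa> v}"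
        using inj by (auto simp: bij_betw_def inj_on_def)
    qed
    also have "W V \<kappa> = W V (restrict \<kappa> V)"
      unfolding W_def using simple_graph_clique[OF insert(1)]
      by (intro prod.cong edge_weight_cong[of V "edges (clique V)"])
        (auto simp: clique_def edges_def)
    finally show ?thesis .
  qed
  have "(\<Sum>\<kappa>\<in>B (insert v V) S. W (insert v V) \<kappa>) =
      (\<Sum>(s, \<kappa>)\<in>(SIGMA s:S. B V (S - {s})). monom 1 1 ^ card {x \<in> S. x < s} * W V \<kappa>)"
  proof (rule sum.reindex_bij_witness[where i = "\<lambda>(s, \<kappa>). \<kappa>(v := s)" and j = "\<lambda>\<kappa>. (\<kappa> v, restrict \<kappa> V)"], goal_cases)
    case (1 \<kappa>)
    then show ?case by (auto simp: B_def PiE_iff extensional_def fun_eq_iff)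
  next
    case (2 \<kappa>)
    then have inj: "inj_on \<kappa> (insert v V)" and "\<kappa> ` insert v V = S"
      by (auto simp: B_def bij_betw_def)
    moreover have "\<kappa> x \<noteq> \<kappa> v" if "x \<in> V" for x
      using inj_onD[OF inj, of x v] that v by blast
    ultimately show ?case
      by (auto simp: B_def bij_betw_def PiE_iff inj_on_restrict_eq)
  next
    case (3 a)
    with v show ?case by (auto simp: B_def PiE_iff extensional_def fun_eq_iff)
  next
    case (4 a)
    then obtain s \<kappa> where a: "a = (s, \<kappa>)" "s \<in> S" "\<kappa> \<in> B V (S - {s})" by auto
    have "bij_betw (\<kappa>(v := s)) V (S - {s})"
      using a v by (subst bij_betw_cong[of V _ \<kappa>]) (auto simp: B_def)
    then have "bij_betw (\<kappa>(v := s)) (insert v V) S"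
      using a v by (auto simp: bij_betw_def)
    with a show ?case by (auto simp: B_def PiE_iff extensional_def)
  next
    case (5 \<kappa>)
    then show ?case by (simp add: W_insert)
  qed
  also have "\<dots> = (\<Sum>s\<in>S. monom 1 1 ^ card {x \<in> S. x < s} * (\<Sum>\<kappa>\<in>B V (S - {s}). W V \<kappa>))"
    using insert(4) finB by (subst sum.Sigma[symmetric]) (auto simp: sum_distrib_left)
  also have "\<dots> = (\<Sum>s\<in>S. monom 1 1 ^ card {x \<in> S. x < s} * qfact (monom 1 1) (card V))"
  proof (intro sum.cong refl)
    fix s assume "s \<in> S"
    then have "card V = card (S - {s})" using insert v by simp
    then show "monom 1 1 ^ card {x \<in> S. x < s} * (\<Sum>\<kappa>\<in>B V (S - {s}). W V \<kappa>) =
        monom 1 1 ^ card {x \<in> S. x < s} * qfact (monom 1 1) (card V)"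
      using insert.IH[of "S - {s}"] insert(4) unfolding B_def W_def by simp
  qed
  also have "\<dots> = qfact (monom 1 1) (card (insert v V))"
    using insert(1,4) v \<open>card S = Suc (card V)\<close>
    by (simp add: sum_distrib_right[symmetric] sum_power_rank qfact_Suc)
  finally show ?case by (simp add: B_def W_def)
qed

text \<open>Proper colorings are injective, so only monomials of sets survive, each with the
  q-factorial as its coefficient. The vertex set is arbitrary because the clique split off from a
  melted lollipop does not start at 1.\<close>

lemma chromatic_qsym_clique:
  assumes "finite V"
  shows "chromatic_qsym (clique V) = qfact qvar (card V) * elem_sym (card V)"
proof (rule mvps_eqI)
  fix M :: "nat multiset"
  note nth = chromatic_qsym_nth[OF simple_graph_clique[OF assms], unfolded verts_clique, of M]
  define P where "P S \<longleftrightarrow> finite S \<and> S \<subseteq> {0<..} \<and> card S = card V \<and> mset_set S = M" for S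
  have "mvps_nth (chromatic_qsym (clique V)) M =
      qfact (monom 1 1) (card V) * of_nat (card {S. P S})"
  proof (cases "\<exists>S. P S")
    case True
    then obtain S where S: "finite S" "S \<subseteq> {0<..}" "card S = card V" "mset_set S = M"
      by (auto simp: P_def)
    have "{S. P S} = {S}" using S by (auto simp: P_def)
    moreover have "colorings V M = {\<kappa>. \<kappa> \<in> V \<rightarrow>\<^sub>E S \<and> bij_betw \<kappa> V S}"
    proof (intro equalityI subsetI CollectI conjI)
      fix \<kappa> assume \<kappa>: "\<kappa> \<in> colorings V M"
      have "\<kappa> ` V = set_mset M" using \<kappa> assms by (auto simp: colorings_def)
      also have "\<dots> = S" using S by (metis finite_set_mset_mset_set)
      finally have "\<kappa> ` V = S" .
      then show "bij_betw \<kappa> V S" using S assms by (simp add: bij_betw_def eq_card_imp_inj_on)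
      show "\<kappa> \<in> V \<rightarrow>\<^sub>E S" using \<kappa> \<open>\<kappa> ` V = S\<close> by (auto simp: colorings_def PiE_iff)
    next
      fix \<kappa> assume "\<kappa> \<in> {\<kappa>. \<kappa> \<in> V \<rightarrow>\<^sub>E S \<and> bij_betw \<kappa> V S}"
      then show "\<kappa> \<in> colorings V M"
        using S by (auto simp: colorings_def PiE_iff bij_betw_def image_mset_mset_set)
    qed
    ultimately show ?thesis
      using sum_edge_weight_clique[of V S] S assms by (simp add: nth)
  next
    case False
    have "(\<Prod>e\<in>edges (clique V). edge_weight \<kappa> e) = 0" if \<kappa>: "\<kappa> \<in> colorings V M" for \<kappa>
    proof -
      have "\<not> inj_on \<kappa> V"
      proof
        assume inj: "inj_on \<kappa> V"
        then have "P (\<kappa> ` V)"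
          using \<kappa> assms by (auto simp: P_def colorings_def PiE_iff card_image image_mset_mset_set)
        with False show False by blast
      qed
      then obtain u v where uv: "u \<in> V" "v \<in> V" "u < v" "\<kappa> u = \<kappa> v"
        by (metis inj_onI linorder_neqE_nat)
      then have "{u, v} \<in> edges (clique V)" by (auto simp: edges_clique)
      moreover have "edge_weight \<kappa> {u, v} = 0" using uv by (simp add: edge_weight_pair)
      ultimately show ?thesis
        using simple_graph_finite_edges[OF simple_graph_clique[OF assms]] by (meson prod_zero)
    qed
    with False show ?thesis by (simp add: nth)
  qed
  then show "mvps_nth (chromatic_qsym (clique V)) M = mvps_nth (qfact qvar (card V) * elem_sym (card V)) M"
    by (simp add: qfact_qvar elem_sym_def P_def)
qed

section \<open>Melting lollipops\<close>

text \<open>For an ordered pair, being an edge is plain arithmetic in every graph family used here;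
  this avoids comparing families of doubletons directly.\<close>

lemma nat_graph_eqI:
  assumes G: "simple_graph G" and H: "simple_graph H" and V: "verts G = verts H"
    and E: "\<And>u v. u < v \<Longrightarrow> {u, v} \<in> edges G \<longleftrightarrow> {u, v} \<in> edges H"
  shows "G = H"
proof -
  have "edges G = edges H"
  proof (intro equalityI subsetI)
    fix e assume e: "e \<in> edges G"
    then obtain u v where "e = {u, v}" "u < v" using G unfolding simple_graph_def by blast
    with e E show "e \<in> edges H" by blast
  next
    fix e assume e: "e \<in> edges H"
    then obtain u v where "e = {u, v}" "u < v" using H unfolding simple_graph_def by blast
    with e E show "e \<in> edges G" by blast
  qed
  with V show ?thesis by (simp add: verts_def edges_def prod_eq_iff)
qed

lemma pair_in_edges_clique: "u < v \<Longrightarrow> {u, v} \<in> edges (clique V) \<longleftrightarrow> u \<in> V \<and> v \<in> V"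
  by (auto simp: edges_clique doubleton_eq_iff)

lemma verts_path_graph [simp]: "verts (path_graph k) = {1..k}"
  by (simp add: path_graph_def verts_def)

lemma pair_in_edges_path_graph:
  "u < v \<Longrightarrow> {u, v} \<in> edges (path_graph k) \<longleftrightarrow> 1 \<le> u \<and> v = Suc u \<and> v \<le> k"
  by (auto simp: path_graph_def edges_def doubleton_eq_iff)

lemma simple_graph_path_graph: "simple_graph (path_graph k)"
  unfolding simple_graph_def
proof (intro conjI ballI)
  fix e assume "e \<in> edges (path_graph k)"
  then obtain j where "e = {j, j + 1}" "1 \<le> j" "j + 1 \<le> k"
    by (auto simp: path_graph_def edges_def)
  then show "\<exists>u v. e = {u, v} \<and> u < v \<and> u \<in> verts (path_graph k) \<and> v \<in> verts (path_graph k)"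
    by (intro exI[of _ j] exI[of _ "j + 1"]) simp
qed simp

lemma verts_melting_lollipop [simp]: "verts (melting_lollipop k m n) = {1..m + n}"
  by (simp add: melting_lollipop_def lollipop_def verts_def)

lemma edges_melting_lollipop:
  "edges (melting_lollipop k m n) =
    ({{j, j + 1} | j. 1 \<le> j \<and> j \<le> n} \<union> edges (clique {n + 1..n + m})) - {{n + 1, n + m - j} | j. j < k}"
  by (simp add: melting_lollipop_def lollipop_def edges_def clique_def)

lemma simple_graph_melting_lollipop:
  assumes "m > 0"
  shows "simple_graph (melting_lollipop k m n)"
  unfolding simple_graph_def
proof (intro conjI ballI)
  fix e assume "e \<in> edges (melting_lollipop k m n)"
  then consider j where "e = {j, j + 1}" "1 \<le> j" "j \<le> n" | "e \<in> edges (clique {n + 1..n + m})"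
    by (auto simp: edges_melting_lollipop)
  then show "\<exists>u v. e = {u, v} \<and> u < v \<and> u \<in> verts (melting_lollipop k m n) \<and> v \<in> verts (melting_lollipop k m n)"
  proof cases
    case 1
    with assms show ?thesis by (intro exI[of _ j] exI[of _ "j + 1"]) simp
  next
    case 2
    then obtain u v where "e = {u, v}" "u < v" "u \<in> {n + 1..n + m}" "v \<in> {n + 1..n + m}"
      using simple_graph_clique[of "{n + 1..n + m}"] by (auto simp: simple_graph_def)
    then show ?thesis by (intro exI[of _ u] exI[of _ v]) simp
  qed
qed simp

text \<open>For v at most n + m, the condition \<open>n + m < v + k\<close> says that v is n + m - j
  for some j < k. As k < m, such a v exceeds n + 1, so n + 1 is the smaller end of every deleted
  edge.\<close>

lemma pair_in_edges_melting_lollipop: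
  assumes "u < v" "k < m"
  shows "{u, v} \<in> edges (melting_lollipop k m n) \<longleftrightarrow>
    1 \<le> u \<and> u \<le> n \<and> v = Suc u \<or> n < u \<and> v \<le> n + m \<and> \<not> (u = n + 1 \<and> n + m < v + k)"
proof -
  have 1: "{u, v} \<in> {{j, j + 1} | j. 1 \<le> j \<and> j \<le> n} \<longleftrightarrow> 1 \<le> u \<and> u \<le> n \<and> v = Suc u"
    using assms by (auto simp: doubleton_eq_iff)
  have 2: "{u, v} \<in> edges (clique {n + 1..n + m}) \<longleftrightarrow> n < u \<and> v \<le> n + m"
    using assms by (auto simp: pair_in_edges_clique)
  have 3: "{u, v} \<in> {{n + 1, n + m - j} | j. j < k} \<longleftrightarrow> u = n + 1 \<and> n + m < v + k \<and> v \<le> n + m"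
  proof
    assume "u = n + 1 \<and> n + m < v + k \<and> v \<le> n + m"
    then have "{u, v} = {n + 1, n + m - (n + m - v)}" "n + m - v < k" by auto
    then show "{u, v} \<in> {{n + 1, n + m - j} | j. j < k}" by blast
  qed (use assms in \<open>auto simp: doubleton_eq_iff\<close>)
  show ?thesis
    unfolding edges_melting_lollipop Diff_iff Un_iff 1 2 3 by auto
qed

lemma melting_lollipop_modular:
  assumes "k + 2 < m"
  shows "chromatic_qsym (melting_lollipop k m n) + qvar * chromatic_qsym (melting_lollipop (k + 2) m n) =
    (1 + qvar) * chromatic_qsym (melting_lollipop (k + 1) m n)"
proof -
  \<comment> \<open>Passing from k to k + 2 deletions removes first the edge from \<open>r\<close>
    to \<open>Suc u\<close>, then the one to \<open>u\<close>. In \<open>E\<close> both are gone,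
    and \<open>u\<close> and \<open>Suc u\<close> are joined to all other vertices of the head
    except \<open>r\<close>.\<close>
  define r u where "r = n + 1" and "u = n + m - k - 1"
  define V E where "V = {1..m + n}" and "E = edges (melting_lollipop (k + 2) m n)"
  have ru: "r < u" and u: "u + k + 1 = n + m" using assms by (auto simp: r_def u_def)
  have V: "r \<in> V" "u \<in> V" "Suc u \<in> V" using assms by (auto simp: r_def u_def V_def)
  have G2: "melting_lollipop (k + 2) m n = (V, E)"
    by (simp add: V_def E_def edges_def verts_def melting_lollipop_def lollipop_def)
  have "m > 0" using assms by simp
  have simple: "simple_graph (V, E)"
    using simple_graph_melting_lollipop[OF \<open>m > 0\<close>, of "k + 2" n] unfolding G2 .
  have E: "{x, y} \<in> E \<longleftrightarrow>
      1 \<le> x \<and> x \<le> n \<and> y = Suc x \<or> n < x \<and> y \<le> n + m \<and> \<not> (x = n + 1 \<and> n + m < y + (k + 2))"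
    if "x < y" for x y
    using pair_in_edges_melting_lollipop[OF that assms, of n] by (simp add: E_def)
  have simple1: "simple_graph (V, insert {r, u} E)"
    using simple V ru by (auto simp: simple_graph_def verts_def edges_def)
  have simple2: "simple_graph (V, insert {r, Suc u} (insert {r, u} E))"
    using simple1 V ru by (auto simp: simple_graph_def verts_def edges_def intro: less_SucI)
  have G1: "melting_lollipop (k + 1) m n = (V, insert {r, u} E)"
  proof (rule nat_graph_eqI[OF _ simple1])
    fix x y :: nat assume xy: "x < y"
    have iff: "{x, y} \<in> edges (V, insert {r, u} E) \<longleftrightarrow> x = r \<and> y = u \<or> {x, y} \<in> E"
      using xy ru by (auto simp: edges_def doubleton_eq_iff)
    have "k + 1 < m" using assms by simp
    show "{x, y} \<in> edges (melting_lollipop (k + 1) m n) \<longleftrightarrow> {x, y} \<in> edges (V, insert {r, u} E)"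
      unfolding iff E[OF xy] pair_in_edges_melting_lollipop[OF xy \<open>k + 1 < m\<close>]
      using u by (cases "x = n + 1") (auto simp: r_def)
  qed (simp_all add: simple_graph_melting_lollipop \<open>m > 0\<close> V_def verts_def[of "(_, _)"])
  have G0: "melting_lollipop k m n = (V, insert {r, Suc u} (insert {r, u} E))"
  proof (rule nat_graph_eqI[OF _ simple2])
    fix x y :: nat assume xy: "x < y"
    have iff: "{x, y} \<in> edges (V, insert {r, Suc u} (insert {r, u} E)) \<longleftrightarrow>
        x = r \<and> (y = u \<or> y = Suc u) \<or> {x, y} \<in> E"
      using xy ru by (auto simp: edges_def doubleton_eq_iff)
    have "k < m" using assms by simp
    show "{x, y} \<in> edges (melting_lollipop k m n) \<longleftrightarrow>
        {x, y} \<in> edges (V, insert {r, Suc u} (insert {r, u} E))"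
      unfolding iff E[OF xy] pair_in_edges_melting_lollipop[OF xy \<open>k < m\<close>]
      using u by (cases "x = n + 1") (auto simp: r_def)
  qed (simp_all add: simple_graph_melting_lollipop \<open>m > 0\<close> V_def verts_def[of "(_, _)"])
  show ?thesis unfolding G0 G1 G2
  proof (rule chromatic_qsym_modular[OF simple V ru])
    show "{u, Suc u} \<in> E" "{r, u} \<notin> E" "{r, Suc u} \<notin> E"
      using ru u E[of u "Suc u"] E[of r u] E[of r "Suc u"] by (auto simp: r_def)
    fix x assume x: "x \<noteq> u" "x \<noteq> Suc u"
    show "{x, u} \<in> E \<longleftrightarrow> {x, Suc u} \<in> E"
    proof (cases "x < u")
      case True
      then show ?thesis using E[of x u] E[of x "Suc u"] ru u by (auto simp: r_def)
    next
      case False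
      then show ?thesis using x E[of u x] E[of "Suc u" x] ru u
        by (auto simp: r_def insert_commute)
    qed
  qed
qed

text \<open>After m - 2 deletions the vertex n + 1 keeps only n + 2 as a neighbor in the head, so it
  joins the path and leaves a clique on m - 1 vertices.\<close>

lemma melting_lollipop_shorter_head:
  assumes "m \<ge> 3"
  shows "melting_lollipop (m - 2) m n = melting_lollipop 0 (m - 1) (n + 1)"
proof (rule nat_graph_eqI)
  fix u v :: nat assume "u < v"
  then show "{u, v} \<in> edges (melting_lollipop (m - 2) m n) \<longleftrightarrow>
      {u, v} \<in> edges (melting_lollipop 0 (m - 1) (n + 1))"
    using assms by (subst (1 2) pair_in_edges_melting_lollipop) auto
qed (use assms in \<open>auto simp: simple_graph_melting_lollipop\<close>)

lemma path_graph_eq_melting_lollipop: "path_graph (n + 2) = melting_lollipop 0 2 n"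
proof (rule nat_graph_eqI)
  fix u v :: nat assume "u < v"
  then show "{u, v} \<in> edges (path_graph (n + 2)) \<longleftrightarrow> {u, v} \<in> edges (melting_lollipop 0 2 n)"
    by (auto simp: pair_in_edges_path_graph pair_in_edges_melting_lollipop)
qed (auto simp: simple_graph_melting_lollipop simple_graph_path_graph)

lemma clique_eq_melting_lollipop: "m > 0 \<Longrightarrow> clique {1..m} = melting_lollipop 0 m 0"
proof (rule nat_graph_eqI)
  fix u v :: nat assume "u < v" "m > 0"
  then show "{u, v} \<in> edges (clique {1..m}) \<longleftrightarrow> {u, v} \<in> edges (melting_lollipop 0 m 0)"
    by (auto simp: pair_in_edges_clique pair_in_edges_melting_lollipop)
qed (auto simp: simple_graph_melting_lollipop simple_graph_clique)

lemma path_graph_1: "path_graph 1 = clique {1}"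
proof (rule nat_graph_eqI)
  fix u v :: nat assume "u < v"
  then show "{u, v} \<in> edges (path_graph 1) \<longleftrightarrow> {u, v} \<in> edges (clique {1})"
    by (auto simp: pair_in_edges_clique pair_in_edges_path_graph)
qed (auto simp: simple_graph_path_graph simple_graph_clique)

lemma chromatic_qsym_melted:
  assumes "m \<ge> 2"
  shows "chromatic_qsym (melting_lollipop (m - 1) m n) =
    qfact qvar (m - 1) * chromatic_qsym (path_graph (n + 1)) * elem_sym (m - 1)"
proof -
  have P: "path_graph (n + 1) = ({1..n + 1}, edges (path_graph (n + 1)))"
    by (simp add: path_graph_def edges_def)
  have K: "clique {n + 2..n + m} = ({n + 2..n + m}, edges (clique {n + 2..n + m}))"
    by (simp add: clique_def edges_def)
  define G where "G = ({1..n + 1} \<union> {n + 2..n + m},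
    edges (path_graph (n + 1)) \<union> edges (clique {n + 2..n + m}))"
  have simple: "simple_graph ({1..n + 1}, edges (path_graph (n + 1)))"
    "simple_graph ({n + 2..n + m}, edges (clique {n + 2..n + m}))"
    using simple_graph_path_graph[of "n + 1"] simple_graph_clique[of "{n + 2..n + m}"] P K by simp_all
  have "melting_lollipop (m - 1) m n = G"
  proof (rule nat_graph_eqI)
    show "simple_graph G"
      using simple unfolding G_def simple_graph_def verts_def edges_def fst_conv snd_conv Ball_def
      by (metis Un_iff finite_Un)
    show "verts (melting_lollipop (m - 1) m n) = verts G" using assms by (auto simp: G_def verts_def[of "(_, _)"])
    fix u v :: nat assume "u < v"
    then show "{u, v} \<in> edges (melting_lollipop (m - 1) m n) \<longleftrightarrow> {u, v} \<in> edges G"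
      using assms
      by (auto simp: G_def edges_def[of "(_, _)"] pair_in_edges_clique pair_in_edges_path_graph
          pair_in_edges_melting_lollipop)
  qed (use assms in \<open>simp add: simple_graph_melting_lollipop\<close>)
  then have "chromatic_qsym (melting_lollipop (m - 1) m n) =
      chromatic_qsym (path_graph (n + 1)) * chromatic_qsym (clique {n + 2..n + m})"
    unfolding G_def using chromatic_qsym_disjoint_union[OF simple] P K by simp
  moreover have "card {n + 2..n + m} = m - 1" by simp
  ultimately show ?thesis by (simp add: chromatic_qsym_clique mult_ac)
qed

section \<open>Counting edges\<close>

lemma card_edges_clique:
  assumes "finite V"
  shows "card (edges (clique V)) = card V choose 2"
proof -
  have "edges (clique V) = {e. e \<subseteq> V \<and> card e = 2}"
    by (auto simp: edges_clique card_2_iff)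
  then show ?thesis using n_subsets[OF assms] by simp
qed

lemma card_edges_melting_lollipop:
  assumes "k < m"
  shows "card (edges (melting_lollipop k m n)) + k = n + (m choose 2)"
proof -
  define A B D where "A = {{j, j + 1} | j. 1 \<le> j \<and> j \<le> n}" and "B = edges (clique {n + 1..n + m})"
    and "D = {{n + 1, n + m - j} | j. j < k}"
  have "A = (\<lambda>j. {j, j + 1}) ` {1..n}" by (auto simp: A_def)
  moreover have "inj_on (\<lambda>j. {j, j + 1}) {1..n}" by (auto simp: inj_on_def doubleton_eq_iff)
  ultimately have A: "finite A" "card A = n" by (simp_all add: card_image)
  have B: "finite B" "card B = m choose 2"
    using card_edges_clique[of "{n + 1..n + m}"]
    by (simp_all add: B_def simple_graph_finite_edges simple_graph_clique)
  have "D = (\<lambda>j. {n + 1, n + m - j}) ` {..<k}" by (auto simp: D_def)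
  moreover have "inj_on (\<lambda>j. {n + 1, n + m - j}) {..<k}"
    using assms by (auto simp: inj_on_def doubleton_eq_iff)
  ultimately have D: "finite D" "card D = k" by (simp_all add: card_image)
  have "A \<inter> B = {}" by (auto simp: A_def B_def edges_clique doubleton_eq_iff)
  then have AB: "card (A \<union> B) = n + (m choose 2)" using A B by (simp add: card_Un_disjoint)
  have "{n + 1, n + m - j} \<in> B" if "j < k" for j
    using that assms by (simp add: B_def pair_in_edges_clique)
  then have "D \<subseteq> B" by (auto simp only: D_def)
  then have "D \<subseteq> A \<union> B" by blast
  then have "card D \<le> card (A \<union> B)" "card ((A \<union> B) - D) = card (A \<union> B) - card D"
    using A B D by (auto intro: card_mono card_Diff_subset)
  then show ?thesis
    using AB D by (simp add: edges_melting_lollipop A_def B_def D_def)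
qed

section \<open>The explicit formula\<close>

text \<open>The bracket of the theorem. By \<open>chromatic_qsym_lollipop\<close> it is the series
  of the lollipop divided by the q-factorial of m - 1.\<close>

definition lollipop_qsym :: "nat \<Rightarrow> nat \<Rightarrow> (nat, int poly) mvps" where
  "lollipop_qsym m n = qint qvar (m + n) * elem_sym (m + n) +
     (\<Sum>i<n. qvar * qint qvar (m + i - 1) * chromatic_qsym (path_graph (n - i)) * elem_sym (m + i))"

text \<open>The summand i = 0 splits off, and shifting i turns m into m + 1. The bracket thus obeys
  the recursion with fixed m + n that the graphs satisfy.\<close>

lemma lollipop_qsym_Suc:
  "lollipop_qsym m (Suc n) = lollipop_qsym (Suc m) n +
     qvar * qint qvar (m - 1) * (chromatic_qsym (path_graph (n + 1)) * elem_sym m)"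
  unfolding lollipop_qsym_def sum.lessThan_Suc_shift by (simp add: mult.assoc add_ac)

lemma chromatic_qsym_melting_lollipop_affine:
  assumes "m \<ge> 2" "k \<le> m - 1"
  shows "chromatic_qsym (melting_lollipop k m n) = chromatic_qsym (melting_lollipop (m - 1) m n) +
    qint qvar (m - 1 - k) *
      (chromatic_qsym (melting_lollipop (m - 2) m n) - chromatic_qsym (melting_lollipop (m - 1) m n))"
proof -
  \<comment> \<open>Counting deletions downwards from m - 1 makes the modular law monic; upwards,
    the new term would carry the factor q. Here \<open>b 0\<close> is the disjoint union and
    \<open>b 1\<close> the lollipop with the smaller head.\<close>
  define b where "b j = chromatic_qsym (melting_lollipop (m - 1 - j) m n)" for j
  have "b (i + 2) + qvar * b i = (1 + qvar) * b (i + 1)" if "i + 2 \<le> m - 1" for i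
  proof -
    define k where "k = m - 1 - (i + 2)"
    have "k + 2 < m" "m - 1 - (i + 1) = k + 1" "m - 1 - i = k + 2"
      using that assms by (auto simp: k_def)
    then show ?thesis using melting_lollipop_modular[of k m n] by (simp only: b_def k_def)
  qed
  then have "b (m - 1 - k) = b 0 + qint qvar (m - 1 - k) * (b 1 - b 0)"
    by (rule qint_recurrence_solution[OF _ diff_le_self])
  moreover have "m - 1 - (m - 1 - k) = k" "m - 1 - 0 = m - 1" "m - 1 - 1 = m - 2"
    using assms by auto
  ultimately show ?thesis by (simp only: b_def)
qed

text \<open>\<open>m\<close> is generalized because the step to a longer path uses the formula for
  the larger head m + 1.\<close>

lemma chromatic_qsym_lollipop:
  assumes "m \<ge> 2"
  shows "chromatic_qsym (melting_lollipop 0 m n) = qfact qvar (m - 1) * lollipop_qsym m n"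
  using assms
proof (induction n arbitrary: m)
  case 0
  then obtain p where "m = Suc p" by (cases m) auto
  with 0 show ?case
    using chromatic_qsym_clique[of "{1..m}"] clique_eq_melting_lollipop[of m]
    by (simp add: lollipop_qsym_def qfact_Suc mult_ac)
next
  case (Suc n)
  then obtain p where p: "m = Suc p" by (cases m) auto
  define Q where "Q = chromatic_qsym (path_graph (n + 1)) * elem_sym m"
  define Y where "Y = chromatic_qsym (melting_lollipop 0 m (Suc n))"
  have melted: "chromatic_qsym (melting_lollipop m (Suc m) n) = qfact qvar m * Q"
    using chromatic_qsym_melted[of "Suc m" n] Suc.prems by (simp add: Q_def mult.assoc)
  \<comment> \<open>The affine law without deletions for head m + 1: the left side is known by
    induction, and the unknown \<open>Y\<close> occurs with the factor [m].\<close>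
  have "qfact qvar m * lollipop_qsym (Suc m) n = qfact qvar m * Q + qint qvar m * (Y - qfact qvar m * Q)"
    using chromatic_qsym_melting_lollipop_affine[of "Suc m" 0 n] Suc.IH[of "Suc m"] Suc.prems
      melting_lollipop_shorter_head[of "Suc m" n] melted
    by (simp add: Y_def)
  then have "qint qvar m * Y =
      qfact qvar m * (lollipop_qsym (Suc m) n - Q) + qint qvar m * (qfact qvar m * Q)"
    by (simp add: algebra_simps)
  also have "\<dots> = qfact qvar m * (lollipop_qsym (Suc m) n + (qint qvar m - 1) * Q)"
    by (simp add: algebra_simps)
  \<comment> \<open>Here [m] - 1 = q [m-1] produces the coefficient in the bracket.\<close>
  also have "\<dots> = qint qvar m * (qfact qvar p * (lollipop_qsym (Suc m) n + qvar * qint qvar p * Q))"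
    by (simp add: p qfact_Suc qint_Suc_left[of _ p] mult.assoc)
  finally have "Y = qfact qvar p * (lollipop_qsym (Suc m) n + qvar * qint qvar p * Q)"
    by (rule qint_qvar_left_cancel[rotated]) (use Suc.prems in simp)
  then show ?case by (simp add: Y_def Q_def p lollipop_qsym_Suc)
qed

text \<open>The series at k = 0 is already known, so the affine law is read backwards to find its
  slope \<open>D\<close>. Identifying the graph with m - 2 deletions as a lollipop of head m - 1
  would instead require m to be at least 3.\<close>

lemma chromatic_qsym_melting_lollipop:
  assumes "m \<ge> 2" "k \<le> m - 1"
  shows "chromatic_qsym (melting_lollipop k m n) =
    qint qvar (m - k - 1) * qfact qvar (m - 2) * lollipop_qsym m n +
    qvar ^ (m - k - 1) * qint qvar k * qfact qvar (m - 2) *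
      chromatic_qsym (path_graph (n + 1)) * elem_sym (m - 1)"
proof -
  define Q where "Q = chromatic_qsym (path_graph (n + 1)) * elem_sym (m - 1)"
  define D where "D = chromatic_qsym (melting_lollipop (m - 2) m n) - chromatic_qsym (melting_lollipop (m - 1) m n)"
  have fact: "qfact qvar (m - 1) = qint qvar (m - 1) * qfact qvar (m - 2)"
  proof -
    have "Suc (m - 2) = m - 1" using assms by simp
    then show ?thesis using qfact_Suc[of qvar "m - 2"] by simp
  qed
  have melted: "chromatic_qsym (melting_lollipop (m - 1) m n) = qfact qvar (m - 1) * Q"
    using chromatic_qsym_melted[OF assms(1)] by (simp add: Q_def mult.assoc)
  have "qfact qvar (m - 1) * lollipop_qsym m n = qfact qvar (m - 1) * Q + qint qvar (m - 1) * D"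
    using chromatic_qsym_melting_lollipop_affine[OF assms(1), of 0 n] chromatic_qsym_lollipop[OF assms(1)] melted
    by (simp add: D_def)
  then have "qint qvar (m - 1) * D = qint qvar (m - 1) * (qfact qvar (m - 2) * (lollipop_qsym m n - Q))"
    unfolding fact by (simp add: algebra_simps)
  then have D: "D = qfact qvar (m - 2) * (lollipop_qsym m n - Q)"
    by (rule qint_qvar_left_cancel[rotated]) (use assms in simp)
  \<comment> \<open>Absorbs the negative multiple of \<open>Q\<close> inside \<open>D\<close>; only
    q^(m-k-1) [k] remains as its coefficient.\<close>
  have split: "qint qvar (m - 1) = qint qvar (m - k - 1) + qvar ^ (m - k - 1) * qint qvar k"
    using assms qint_add[of qvar "m - k - 1" k] by simp
  have "m - 1 - k = m - k - 1" by simp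
  then have "chromatic_qsym (melting_lollipop k m n) =
      qint qvar (m - 1) * qfact qvar (m - 2) * Q +
      qint qvar (m - k - 1) * (qfact qvar (m - 2) * (lollipop_qsym m n - Q))"
    using chromatic_qsym_melting_lollipop_affine[OF assms, of n] melted fact D[unfolded D_def] by simp
  also have "\<dots> = qint qvar (m - k - 1) * qfact qvar (m - 2) * lollipop_qsym m n +
      qvar ^ (m - k - 1) * qint qvar k * qfact qvar (m - 2) * Q"
    unfolding split by (simp add: algebra_simps)
  finally show ?thesis by (simp add: Q_def mult.assoc)
qed

section \<open>Positivity and unimodality\<close>

lemma e_nonneg_0: "e_nonneg 0"
  unfolding e_nonneg_def by (intro exI[of _ "{}"]) simp

lemma e_nonneg_e_partition: "0 \<notin># \<mu> \<Longrightarrow> e_nonneg (e_partition \<mu>)"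
  unfolding e_nonneg_def by (intro exI[of _ "{\<mu>}"] exI[of _ "\<lambda>_. 1"]) simp

lemma e_nonneg_add:
  assumes "e_nonneg f" "e_nonneg g"
  shows "e_nonneg (f + g)"
proof -
  obtain S a where
    S: "finite S" "\<forall>\<mu>\<in>S. 0 \<notin># \<mu> \<and> 0 \<le> a \<mu>" "f = (\<Sum>\<mu>\<in>S. of_int (a \<mu>) * e_partition \<mu>)"
    using assms(1) unfolding e_nonneg_def by blast
  obtain T b where
    T: "finite T" "\<forall>\<mu>\<in>T. 0 \<notin># \<mu> \<and> 0 \<le> b \<mu>" "g = (\<Sum>\<mu>\<in>T. of_int (b \<mu>) * e_partition \<mu>)"
    using assms(2) unfolding e_nonneg_def by blast
  define c where "c \<mu> = (if \<mu> \<in> S then a \<mu> else 0) + (if \<mu> \<in> T then b \<mu> else 0)" for \<mu>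
  have "f = (\<Sum>\<mu>\<in>S \<union> T. of_int (if \<mu> \<in> S then a \<mu> else 0) * e_partition \<mu>)"
    unfolding S(3) using S T by (intro sum.mono_neutral_cong_left) auto
  moreover have "g = (\<Sum>\<mu>\<in>S \<union> T. of_int (if \<mu> \<in> T then b \<mu> else 0) * e_partition \<mu>)"
    unfolding T(3) using S T by (intro sum.mono_neutral_cong_left) auto
  ultimately have "f + g = (\<Sum>\<mu>\<in>S \<union> T. of_int (c \<mu>) * e_partition \<mu>)"
    unfolding c_def of_int_add distrib_right sum.distrib by (simp only:)
  moreover have "\<forall>\<mu>\<in>S \<union> T. 0 \<notin># \<mu> \<and> 0 \<le> c \<mu>" using S T by (auto simp: c_def)
  ultimately show ?thesis
    unfolding e_nonneg_def using S(1) T(1) by (intro exI[of _ "S \<union> T"] exI[of _ c]) simp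
qed

text \<open>Counterpart of \<open>e_partition\<close> over Z[q], where multiplication by powers of q
  takes place; the q-coefficients themselves lie over Z.\<close>

definition e_product :: "nat multiset \<Rightarrow> (nat, int poly) mvps" where
  "e_product \<mu> = (\<Prod>i\<in>#\<mu>. elem_sym i)"

lemma sum_const_poly: "(\<Sum>x\<in>S. [:f x:]) = [:\<Sum>x\<in>S. f x:]"
  by (induction S rule: infinite_finite_induct) auto

lemma e_product_nth: "mvps_nth (e_product \<mu>) M = [:mvps_nth (e_partition \<mu>) M:]"
proof (induction \<mu> arbitrary: M)
  case empty
  then show ?case by (simp add: e_product_def e_partition_def mvps_nth_one)
next
  case (add i \<mu>)
  have "mvps_nth (elem_sym i :: (nat, int poly) mvps) A = [:mvps_nth (elem_sym i) A:]" for A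
    by (simp add: elem_sym_def of_nat_poly)
  then have "mvps_nth (e_product (add_mset i \<mu>)) M =
      (\<Sum>A | A \<subseteq># M. [:mvps_nth (elem_sym i) A * mvps_nth (e_partition \<mu>) (M - A):])"
    using add by (simp add: e_product_def mvps_nth_mult mult.commute)
  then show ?case by (simp add: sum_const_poly e_partition_def mvps_nth_mult)
qed

lemma q_coeff_0: "q_coeff 0 t = 0"
  by (rule mvps_eqI) (simp add: q_coeff_def)

lemma q_coeff_add: "q_coeff (f + g) t = q_coeff f t + q_coeff g t"
  by (rule mvps_eqI) (simp add: q_coeff_def)

text \<open>The polynomial q^j [l+1] has coefficient 1 exactly at the exponents from j to j + l, and
  \<open>e_product\<close> is constant in q.\<close>

lemma q_coeff_string:
  "q_coeff (qvar ^ j * qint qvar (Suc l) * e_product \<mu>) t =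
    (if int j \<le> t \<and> t \<le> int (j + l) then e_partition \<mu> else 0)"
proof (rule mvps_eqI)
  fix M
  define p :: "int poly" where "p = monom 1 1 ^ j * qint (monom 1 1) (Suc l)"
  have "p = (\<Sum>i<Suc l. monom 1 (j + i))"
    by (simp add: p_def qint_def sum_distrib_left monom_power mult_monom del: sum.lessThan_Suc)
  then have "coeff p s = (\<Sum>i<Suc l. if j + i = s then 1 else 0)" for s
    by (simp add: coeff_sum del: sum.lessThan_Suc)
  also have "(\<Sum>i<Suc l. if j + i = s then 1 else 0) = (if j \<le> s \<and> s \<le> j + l then 1 else 0 :: int)" for s
  proof (cases "j \<le> s")
    case True
    then have "(\<Sum>i<Suc l. if j + i = s then 1 else 0 :: int) = (\<Sum>i<Suc l. if i = s - j then 1 else 0)"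
      by (intro sum.cong) auto
    with True show ?thesis by (auto simp del: sum.lessThan_Suc)
  qed auto
  finally have coeff: "coeff p s = (if j \<le> s \<and> s \<le> j + l then 1 else 0)" for s .
  have "qvar ^ j * qint qvar (Suc l) * e_product \<mu> = mvps_const p * e_product \<mu>"
    by (simp only: p_def qint_qvar mvps_const_mult mvps_const_power flip: qvar_def)
  then have "mvps_nth (qvar ^ j * qint qvar (Suc l) * e_product \<mu>) M = [:mvps_nth (e_partition \<mu>) M:] * p"
    by (simp only: mvps_nth_const_mult e_product_nth mult.commute[of p])
  then show "mvps_nth (q_coeff (qvar ^ j * qint qvar (Suc l) * e_product \<mu>) t) M =
      mvps_nth (if int j \<le> t \<and> t \<le> int (j + l) then e_partition \<mu> else 0) M"
    by (auto simp: q_coeff_def coeff)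
qed

text \<open>
  A polynomial in \<open>q\<close> with nonnegative coefficients is symmetric about \<open>d / 2\<close> and unimodal iff it is a
  nonnegative combination of the strings \<open>q\<^sup>j [l + 1]\<close> with \<open>2 j + l = d\<close>.
\<close>

inductive_set string_cone :: "nat \<Rightarrow> (nat, int poly) mvps set" for d where
  zero: "0 \<in> string_cone d"
| add: "f \<in> string_cone d \<Longrightarrow> g \<in> string_cone d \<Longrightarrow> f + g \<in> string_cone d"
| string: "2 * j + l = d \<Longrightarrow> 0 \<notin># \<mu> \<Longrightarrow> qvar ^ j * qint qvar (Suc l) * e_product \<mu> \<in> string_cone d"

text \<open>A string occupies the exponents from j to j + l, an interval symmetric about d / 2 since
  2 j + l = d. A step upwards below the center can enter this interval but not leave it. All three
  claims are additive.\<close>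

lemma string_cone_unimodal:
  assumes "f \<in> string_cone d"
  shows "e_nonneg (q_coeff f t)" "q_coeff f t = q_coeff f (int d - t)"
    and "2 * t < int d - 1 \<Longrightarrow> e_nonneg (q_coeff f (t + 1) - q_coeff f t)"
  using assms
proof (induction rule: string_cone.induct)
  case (add f g)
  {
    case 1
    with add show ?case by (simp add: q_coeff_add e_nonneg_add)
  next
    case 2
    with add show ?case by (metis q_coeff_add)
  next
    case 3
    with add have "e_nonneg ((q_coeff f (t + 1) - q_coeff f t) + (q_coeff g (t + 1) - q_coeff g t))"
      by (intro e_nonneg_add)
    then show ?case by (simp add: q_coeff_add algebra_simps)
  }
qed (auto simp: q_coeff_0 q_coeff_string e_nonneg_0 e_nonneg_e_partition)

lemma string_cone_sum:
  "(\<And>i. i \<in> I \<Longrightarrow> f i \<in> string_cone d) \<Longrightarrow> sum f I \<in> string_cone d"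
  by (induction I rule: infinite_finite_induct) (auto intro: string_cone.intros)

text \<open>The Clebsch--Gordan rule, through \<open>[a + 1] [b + 1] = [a + b + 1] + q [a] [b]\<close>.\<close>

lemma qint_mult_qint_in_string_cone:
  assumes "2 * j + a + b = d" "0 \<notin># \<mu>"
  shows "qvar ^ j * (qint qvar (Suc a) * qint qvar (Suc b)) * e_product \<mu> \<in> string_cone d"
  using assms(1)
proof (induction a arbitrary: j b)
  case 0
  then show ?case using string_cone.string[of j b d \<mu>] assms(2) by simp
next
  case (Suc a)
  show ?case
  proof (cases b)
    case 0
    then show ?thesis using string_cone.string[of j "Suc a" d \<mu>] assms(2) Suc.prems by simp
  next
    case b: (Suc c)
    have "qint qvar (Suc (Suc a)) * qint qvar (Suc b) =
        qint qvar (Suc b) + qvar * qint qvar (Suc a) * (qint qvar b + qvar ^ b)"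
      by (simp add: qint_Suc_left[of _ "Suc a"] qint_Suc[of _ b] algebra_simps)
    also have "\<dots> = qint qvar (Suc b) + qvar ^ Suc b * qint qvar (Suc a) +
        qvar * (qint qvar (Suc a) * qint qvar b)"
      by (simp add: algebra_simps)
    also have "qint qvar (Suc b) + qvar ^ Suc b * qint qvar (Suc a) = qint qvar (Suc (Suc a + b))"
      using qint_add[of qvar "Suc b" "Suc a"] by (simp add: add_ac)
    finally have "qvar ^ j * (qint qvar (Suc (Suc a)) * qint qvar (Suc b)) * e_product \<mu> =
        qvar ^ j * qint qvar (Suc (Suc a + b)) * e_product \<mu> +
        qvar ^ Suc j * (qint qvar (Suc a) * qint qvar (Suc c)) * e_product \<mu>"
      by (simp add: b algebra_simps)
    moreover have "qvar ^ j * qint qvar (Suc (Suc a + b)) * e_product \<mu> \<in> string_cone d"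
      using Suc.prems assms(2) by (intro string_cone.string) auto
    \<comment> \<open>Raising j by one and lowering both other parameters by one preserves 2 j + a +
      b.\<close>
    moreover have "qvar ^ Suc j * (qint qvar (Suc a) * qint qvar (Suc c)) * e_product \<mu> \<in> string_cone d"
      using Suc.prems b by (intro Suc.IH) auto
    ultimately show ?thesis by (simp only: string_cone.add)
  qed
qed

text \<open>Bilinearity reduces this to two strings: powers of q add, partitions unite, and the
  Clebsch-Gordan rule expands the product of the q-integers.\<close>

lemma string_cone_mult:
  assumes "f \<in> string_cone a" "g \<in> string_cone b" "a + b = d"
  shows "f * g \<in> string_cone d"
  using assms(1)
proof (induction rule: string_cone.induct)
  case (string j l \<mu>)
  note f = string
  from assms(2) show ?case
  proof (induction rule: string_cone.induct)
    case (string i h \<nu>)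
    have "qvar ^ (j + i) * (qint qvar (Suc l) * qint qvar (Suc h)) * e_product (\<mu> + \<nu>) \<in> string_cone d"
      using f string assms(3) by (intro qint_mult_qint_in_string_cone) auto
    then show ?case by (simp only: e_product_def power_add mult_ac image_mset_union prod_mset_Un)
  qed (auto simp: distrib_left intro: string_cone.intros)
qed (auto simp: distrib_right intro: string_cone.intros)

section \<open>Cone membership of the summands of the formula\<close>

lemma qint_in_string_cone: "l = Suc d \<Longrightarrow> qint qvar l \<in> string_cone d"
  using string_cone.string[of 0 d d "{#}"] by (simp add: e_product_def)

lemma qvar_power_in_string_cone: "d = 2 * j \<Longrightarrow> qvar ^ j \<in> string_cone d"
  using string_cone.string[of j 0 d "{#}"] by (simp add: e_product_def)

lemma elem_sym_in_string_cone: "k > 0 \<Longrightarrow> elem_sym k \<in> string_cone 0"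
  using string_cone.string[of 0 0 0 "{#k#}"] by (simp add: e_product_def)

lemma qfact_in_string_cone: "qfact qvar k \<in> string_cone (k choose 2)"
proof (induction k)
  case 0
  then show ?case using qvar_power_in_string_cone[of 0 0] by (simp add: binomial_eq_0)
next
  case (Suc k)
  show ?case unfolding qfact_Suc
    by (rule string_cone_mult[OF qint_in_string_cone Suc]) (simp_all add: numeral_2_eq_2)
qed

text \<open>In the summand for i, the indices 2, m + i - 2, n - i - 1 and 0 of the factors add up to
  m + n - 1. Paths enter through a hypothesis limited to n vertices, so that the lemma can serve
  inside the induction on paths.\<close>

lemma lollipop_qsym_in_string_cone:
  assumes "m \<ge> 2" "d = m + n - 1"
    and path: "\<And>i. i < n \<Longrightarrow> chromatic_qsym (path_graph (Suc i)) \<in> string_cone i"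
  shows "lollipop_qsym m n \<in> string_cone d"
  unfolding lollipop_qsym_def
proof (intro string_cone.add string_cone_sum)
  show "qint qvar (m + n) * elem_sym (m + n) \<in> string_cone d"
    by (rule string_cone_mult[OF qint_in_string_cone elem_sym_in_string_cone]) (use assms in auto)
  fix i assume i: "i \<in> {..<n}"
  have "qvar * qint qvar (m + i - 1) \<in> string_cone (m + i)"
    by (rule string_cone_mult[OF qvar_power_in_string_cone[of 2 1, simplified] qint_in_string_cone[of _ "m + i - 2"]])
      (use assms in auto)
  moreover have "chromatic_qsym (path_graph (n - i)) \<in> string_cone (n - i - 1)"
    using path[of "n - i - 1"] i by (simp add: Suc_diff_Suc)
  ultimately have "qvar * qint qvar (m + i - 1) * chromatic_qsym (path_graph (n - i)) \<in> string_cone d"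
    by (rule string_cone_mult) (use assms i in auto)
  then show "qvar * qint qvar (m + i - 1) * chromatic_qsym (path_graph (n - i)) * elem_sym (m + i) \<in> string_cone d"
    by (rule string_cone_mult[OF _ elem_sym_in_string_cone]) (use assms in auto)
qed

text \<open>A path on l + 2 vertices is the lollipop with a head of two vertices, and its formula
  involves only paths on at most l vertices; hence the strong induction.\<close>

lemma chromatic_qsym_path_in_string_cone: "chromatic_qsym (path_graph (Suc n)) \<in> string_cone n"
proof (induction n rule: less_induct)
  case (less n)
  show ?case
  proof (cases n)
    case 0
    then show ?thesis
      using path_graph_1 chromatic_qsym_clique[of "{1}"] elem_sym_in_string_cone[of 1]
      by (simp add: qfact_Suc)
  next
    case (Suc l)
    then have "chromatic_qsym (path_graph (Suc n)) = lollipop_qsym 2 l"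
      using path_graph_eq_melting_lollipop[of l] chromatic_qsym_lollipop[of 2 l]
      by (simp add: qfact_Suc)
    moreover have "lollipop_qsym 2 l \<in> string_cone n"
      using less Suc by (intro lollipop_qsym_in_string_cone) auto
    ultimately show ?thesis by simp
  qed
qed

lemma chromatic_qsym_melting_lollipop_in_string_cone:
  assumes "m \<ge> 2" "k \<le> m - 1"
  shows "chromatic_qsym (melting_lollipop k m n) \<in> string_cone (card (edges (melting_lollipop k m n)))"
proof -
  define d where "d = card (edges (melting_lollipop k m n))"
  obtain p where p: "m = p + 2" using assms(1) by (metis add.commute le_Suc_ex)
  have "d + k = n + (m choose 2)"
    unfolding d_def using assms by (intro card_edges_melting_lollipop) simp
  \<comment> \<open>Uses that (p + 2 choose 2) is (p choose 2) + 2 p + 1; \<open>k\<close> stays on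
    the left to avoid truncated subtraction.\<close>
  then have d: "d + k = n + (p choose 2) + p + p + 1"
    by (simp add: p numeral_2_eq_2)
  have "qint qvar (m - k - 1) * qfact qvar (m - 2) * lollipop_qsym m n \<in> string_cone d"
  \<comment> \<open>Here the first factor is [0] = 0, which would need the index -1, so the summand
    is handled as zero. The other summand is split at k = 0 for the same reason.\<close>
  proof (cases "k = m - 1")
    case True
    then show ?thesis using assms by (simp add: string_cone.zero)
  next
    case False
    then have k: "k \<le> p" using assms p by simp
    have "qint qvar (m - k - 1) * qfact qvar (m - 2) \<in> string_cone (p - k + (p choose 2))"
      by (rule string_cone_mult[OF qint_in_string_cone[of _ "p - k"] qfact_in_string_cone]) (use k p in auto)
    moreover have "lollipop_qsym m n \<in> string_cone (m + n - 1)"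
      using assms(1) by (intro lollipop_qsym_in_string_cone chromatic_qsym_path_in_string_cone) auto
    ultimately show ?thesis
      by (rule string_cone_mult) (use d k p in simp)
  qed
  moreover have "qvar ^ (m - k - 1) * qint qvar k * qfact qvar (m - 2) *
      chromatic_qsym (path_graph (n + 1)) * elem_sym (m - 1) \<in> string_cone d"
  proof (cases k)
    case 0
    then show ?thesis by (simp add: string_cone.zero)
  next
    case (Suc l)
    have "qvar ^ (m - k - 1) * qint qvar k \<in> string_cone (2 * (p + 1 - k) + l)"
      by (rule string_cone_mult[OF qvar_power_in_string_cone[of "2 * (p + 1 - k)"] qint_in_string_cone[of _ l]])
        (use Suc p in auto)
    then have "qvar ^ (m - k - 1) * qint qvar k * qfact qvar (m - 2) \<in> string_cone (2 * (p + 1 - k) + l + (p choose 2))"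
      by (rule string_cone_mult[OF _ qfact_in_string_cone]) (use p in auto)
    then have "qvar ^ (m - k - 1) * qint qvar k * qfact qvar (m - 2) *
        chromatic_qsym (path_graph (n + 1)) \<in> string_cone d"
      by (rule string_cone_mult[OF _ chromatic_qsym_path_in_string_cone[of n, unfolded Suc_eq_plus1]])
        (use Suc p d assms in auto)
    then show ?thesis
      by (rule string_cone_mult[OF _ elem_sym_in_string_cone]) (use assms in auto)
  qed
  ultimately show ?thesis
    unfolding chromatic_qsym_melting_lollipop[OF assms] d_def[symmetric] by (rule string_cone.add)
qed

theorem theorem4p9:
  fixes m n k :: nat
  assumes "2 \<le> m" and "k \<le> m - 1"
  shows "chromatic_qsym (melting_lollipop k m n) =
      qint qvar (m - k - 1) * qfact qvar (m - 2) *
        (qint qvar (m + n) * elem_sym (m + n) +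
         (\<Sum>i<n. qvar * qint qvar (m + i - 1) *
            chromatic_qsym (path_graph (n - i)) * elem_sym (m + i))) +
      qvar ^ (m - k - 1) * qint qvar k * qfact qvar (m - 2) *
        chromatic_qsym (path_graph (n + 1)) * elem_sym (m - 1)
    \<and> e_positive (chromatic_qsym (melting_lollipop k m n))
    \<and> e_unimodal (chromatic_qsym (melting_lollipop k m n))
        (of_nat (card (edges (melting_lollipop k m n))) / 2)"
proof (intro conjI)
  note cone = string_cone_unimodal[OF chromatic_qsym_melting_lollipop_in_string_cone[OF assms, of n]]
  show "e_positive (chromatic_qsym (melting_lollipop k m n))"
    unfolding e_positive_def using cone(1) by blast
  let ?d = "card (edges (melting_lollipop k m n))"
  have "2 * t < int ?d - 1" if "of_int t < (of_nat ?d / 2 - 1 / 2 :: rat)" for t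
  proof -
    from that have "of_int (2 * t) < (of_int (int ?d - 1) :: rat)" by (simp add: field_simps)
    then show ?thesis by (simp only: of_int_less_iff)
  qed
  with cone(2,3) show "e_unimodal (chromatic_qsym (melting_lollipop k m n)) (of_nat ?d / 2)"
    unfolding e_unimodal_def by (intro exI[of _ "int ?d"] conjI allI impI) auto
qed (use chromatic_qsym_melting_lollipop[OF assms] in \<open>simp only: lollipop_qsym_def\<close>)

end
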